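(* For every word-hyperbolic group $\Gamma$, $H^i_{(\infty)}(\Gamma;\mathbb{Z})=0$ for all $i>1$.
   Context: Norm on an abelian group $A$: a function $|\cdot|:A\to\mathbb{R}_{\ge 0}$ with $|a|=0$ iff $a=0$, $|a|=|-a|$, and $|a+b|\le|a|+|b|$. For a CW complex $X$ and a normed abelian group $A$, let $E_n(X)$ be the set of $n$-cells and $C^n(X;A)=\operatorname{Hom}(\bigoplus_{E_n(X)}\mathbb{Z},A)$ the cellular $n$-cochains. The bounded cochains $C^n_{(\infty)}(X;A)\subset C^n(X;A)$ are those $\phi$ for which there is $b$ with $|\phi(e)|\le b$ for all $e\in E_n(X)$; they form a subcomplex under the cellular coboundary, and its cohomology is the $\ell_\infty$-cohomology $H^*_{(\infty)}(X;A)$ (for finitely generated $A$ it does not depend on the choice of norm). For a group $\Gamma$ admitting a $K(\Gamma,1)$ all of whose skeleta are finite complexes, $H^i_{(\infty)}(\Gamma;A):=H^i_{(\infty)}(X;A)$ where $X$ is the universal cover of such a $K(\Gamma,1)$ with the lifted CW structure (this is independent of the choice of such $K(\Gamma,1)$); hyperbolic groups admit such a $K(\Gamma,1)$. *)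

theory Defs
  imports Complex_Main "HOL-Algebra.Group" "HOL-Algebra.Generated_Groups"
begin

definition word_length :: "'g monoid \<Rightarrow> 'g set \<Rightarrow> 'g \<Rightarrow> nat" where
  "word_length G S x =
     (LEAST n. \<exists>ws. length ws = n \<and> set ws \<subseteq> S \<union> m_inv G ` S \<and>
                   foldr (\<otimes>\<^bsub>G\<^esub>) ws \<one>\<^bsub>G\<^esub> = x)"

definition word_dist :: "'g monoid \<Rightarrow> 'g set \<Rightarrow> 'g \<Rightarrow> 'g \<Rightarrow> real" where
  "word_dist G S x y = real (word_length G S (inv\<^bsub>G\<^esub> x \<otimes>\<^bsub>G\<^esub> y))"

definition gromov_product :: "'g monoid \<Rightarrow> 'g set \<Rightarrow> 'g \<Rightarrow> 'g \<Rightarrow> 'g \<Rightarrow> real" where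
  "gromov_product G S w x y =
     (word_dist G S x w + word_dist G S y w - word_dist G S x y) / 2"

definition hyperbolic_group :: "'g monoid \<Rightarrow> bool" where
  "hyperbolic_group G \<longleftrightarrow> group G \<and>
     (\<exists>S \<delta>. finite S \<and> S \<subseteq> carrier G \<and> generate G S = carrier G \<and> \<delta> \<ge> 0 \<and>
        (\<forall>w\<in>carrier G. \<forall>x\<in>carrier G. \<forall>y\<in>carrier G. \<forall>z\<in>carrier G.
           gromov_product G S w x z \<ge>
             min (gromov_product G S w x y) (gromov_product G S w y z) - \<delta>))"

section \<open>Free ZG-resolutions of finite type (cellular chains of universal covers)\<close>

text \<open>The n-th chain group is the free ZG-module with basis e_0..e_{r-1}; its
Z-basis consists of the "cells" g e_i, encoded as pairs (g,i). A chain is a finitely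
supported integer function on cells.\<close>
definition chains :: "'g monoid \<Rightarrow> nat \<Rightarrow> ('g \<times> nat \<Rightarrow> int) set" where
  "chains G r = {f. finite {c. f c \<noteq> 0} \<and>
                    (\<forall>g i. f (g, i) \<noteq> 0 \<longrightarrow> g \<in> carrier G \<and> i < r)}"

definition translate :: "'g monoid \<Rightarrow> 'g \<Rightarrow> ('g \<times> nat \<Rightarrow> int) \<Rightarrow> ('g \<times> nat \<Rightarrow> int)" where
  "translate G g f = (\<lambda>(h, i). if h \<in> carrier G then f (inv\<^bsub>G\<^esub> g \<otimes>\<^bsub>G\<^esub> h, i) else 0)"

definition bdry :: "'g monoid \<Rightarrow> (nat \<Rightarrow> ('g \<times> nat \<Rightarrow> int)) \<Rightarrow> ('g \<times> nat \<Rightarrow> int) \<Rightarrow> ('g \<times> nat \<Rightarrow> int)" where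
  "bdry G b f = (\<lambda>x. \<Sum>c\<in>{c. f c \<noteq> 0}. f c * translate G (fst c) (b (snd c)) x)"

definition aug :: "(nat \<Rightarrow> int) \<Rightarrow> ('g \<times> nat \<Rightarrow> int) \<Rightarrow> int" where
  "aug eps f = (\<Sum>c\<in>{c. f c \<noteq> 0}. f c * eps (snd c))"

text \<open>k n is the rank of the n-th free module, d n j (n \<ge> 1) is the boundary of the
j-th basis element of degree n; the sequence ... \<rightarrow> F_1 \<rightarrow> F_0 \<rightarrow> Z \<rightarrow> 0 is exact.\<close>
definition free_resolution_fin_type ::
  "'g monoid \<Rightarrow> (nat \<Rightarrow> nat) \<Rightarrow> (nat \<Rightarrow> nat \<Rightarrow> ('g \<times> nat \<Rightarrow> int)) \<Rightarrow> (nat \<Rightarrow> int) \<Rightarrow> bool" where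
  "free_resolution_fin_type G k d eps \<longleftrightarrow>
     (\<forall>n\<ge>1. \<forall>j<k n. d n j \<in> chains G (k (n - 1))) \<and>
     (\<exists>f\<in>chains G (k 0). aug eps f = 1) \<and>
     (\<forall>f\<in>chains G (k 0). aug eps f = 0 \<longleftrightarrow> (\<exists>c\<in>chains G (k 1). bdry G (d 1) c = f)) \<and>
     (\<forall>n\<ge>1. \<forall>f\<in>chains G (k n).
        bdry G (d n) f = (\<lambda>_. 0) \<longleftrightarrow> (\<exists>c\<in>chains G (k (Suc n)). bdry G (d (Suc n)) c = f))"

text \<open>An n-cochain is an integer function on the n-cells (g,j), g in G, j < k n.\<close>
definition bounded_cochain :: "'g monoid \<Rightarrow> (nat \<Rightarrow> nat) \<Rightarrow> nat \<Rightarrow> ('g \<times> nat \<Rightarrow> int) \<Rightarrow> bool" where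
  "bounded_cochain G k n \<phi> \<longleftrightarrow> (\<exists>b. \<forall>g\<in>carrier G. \<forall>j<k n. \<bar>\<phi> (g, j)\<bar> \<le> b)"

text \<open>Coboundary of an n-cochain, evaluated at the (n+1)-cell g e_j:
phi(d(g e_j)).\<close>
definition coboundary :: "'g monoid \<Rightarrow> (nat \<Rightarrow> nat \<Rightarrow> ('g \<times> nat \<Rightarrow> int)) \<Rightarrow> nat \<Rightarrow> ('g \<times> nat \<Rightarrow> int) \<Rightarrow> ('g \<times> nat \<Rightarrow> int)" where
  "coboundary G d n \<phi> = (\<lambda>(g, j). \<Sum>c\<in>{c. d (Suc n) j c \<noteq> 0}. d (Suc n) j c * \<phi> (g \<otimes>\<^bsub>G\<^esub> fst c, snd c))"

definition linf_cohomology_vanishes ::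
  "'g monoid \<Rightarrow> (nat \<Rightarrow> nat) \<Rightarrow> (nat \<Rightarrow> nat \<Rightarrow> ('g \<times> nat \<Rightarrow> int)) \<Rightarrow> nat \<Rightarrow> bool" where
  "linf_cohomology_vanishes G k d n \<longleftrightarrow>
     (\<forall>\<phi>. bounded_cochain G k n \<phi> \<and>
           (\<forall>g\<in>carrier G. \<forall>j<k (Suc n). coboundary G d n \<phi> (g, j) = 0) \<longrightarrow>
        (\<exists>\<psi>. bounded_cochain G k (n - 1) \<psi> \<and>
             (\<forall>g\<in>carrier G. \<forall>j<k n. coboundary G d (n - 1) \<psi> (g, j) = \<phi> (g, j))))"

end

theory Submission
  imports Defs
begin

text \<open>
  A bounded cocycle on the resolution is pulled back to an integral cocycle \<open>\<Phi>\<close> on the homogeneous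
  bar complex which is normalized and bounded on simplices of bounded diameter. It is enough to find
  a primitive with the same bound: a primitive on the bar complex is transported back along a chain
  map of resolutions, and the error is corrected by an equivariant chain homotopy, which is bounded
  because the modules are finitely generated.

  On the bar complex a real primitive \<open>\<Psi>\<close> is built on balls of growing radius around \<open>1\<close>: project a
  simplex to the previous ball by choosing, independently and uniformly for each vertex, a point near
  a geodesic to \<open>1\<close>, and average the value of \<open>\<Psi>\<close> on the projection, corrected by \<open>\<Phi>\<close> on the prism.
  Hyperbolicity makes the projections of small simplices small, and two vertices are projected to
  the same point with probability bounded below. Since \<open>\<Psi>\<close> vanishes on degenerate simplices and has
  degree at least \<open>1\<close>, averaging is a contraction up to a bounded term, so \<open>\<Psi>\<close> stays bounded.
  Rounding \<open>\<Psi>\<close> on the cone from \<open>1\<close> makes it integral.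
\<close>

section \<open>Cochains on lists\<close>

text \<open>A single choice of projections would also give a primitive, but every level adds a prism
  term of size up to some constant \<open>B\<close>, and the number of levels is unbounded. If two
  vertices merge with probability at least \<open>q\<close>, a bound \<open>M\<close> on one sphere
  becomes \<open>(1 - q) * M + B\<close> on the next, so the errors form a geometric series with
  limit \<open>B / q\<close>. For \<open>i = 1\<close> the primitive would live on single vertices
  and there would be no pair to merge.

  The primitive is not equivariant, since the base point singles out the balls. What survives the
  transport is a bound for each diameter: a cell of the resolution corresponds, up to translation,
  to one of finitely many combinations of bar simplices. Conversely, simplices of diameter at most
  \<open>D\<close> fall into finitely many translation classes, which is why the pullback of a
  bounded cochain is bounded on them, though perhaps not on all simplices.\<close>

text \<open>The recursion unfolds to the alternating sum over the omitted entries; likewise \<open>prism\<close> is the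
  alternating sum of \<open>P\<close> over the lists \<open>x\<^sub>0, \<dots>, x\<^sub>i, Y x\<^sub>i, \<dots>, Y x\<^sub>n\<close>.\<close>

fun cobd :: "('a list \<Rightarrow> 'b::ab_group_add) \<Rightarrow> 'a list \<Rightarrow> 'b" where
  "cobd P [] = 0"
| "cobd P (x # xs) = P xs - cobd (\<lambda>ys. P (x # ys)) xs"

fun prism :: "('a \<Rightarrow> 'a) \<Rightarrow> ('a list \<Rightarrow> 'b::ab_group_add) \<Rightarrow> 'a list \<Rightarrow> 'b" where
  "prism Y P [] = 0"
| "prism Y P (x # xs) = P (x # Y x # map Y xs) - prism Y (\<lambda>ys. P (x # ys)) xs"

lemma cobd_zero [simp]: "cobd (\<lambda>_. 0) xs = 0"
  by (induction xs) auto

lemma cobd_diff: "cobd (\<lambda>ys. P ys - Q ys) xs = cobd P xs - cobd Q xs"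
  by (induction xs arbitrary: P Q) auto

lemma cobd_add: "cobd (\<lambda>ys. P ys + Q ys) xs = cobd P xs + cobd Q xs"
  by (induction xs arbitrary: P Q) auto

lemma cobd_cmult: "cobd (\<lambda>ys. c * P ys) xs = c * cobd P xs" for c :: "'b::ring"
  by (induction xs arbitrary: P) (auto simp: algebra_simps)

lemma cobd_sum: "cobd (\<lambda>ys. \<Sum>i\<in>I. P i ys) xs = (\<Sum>i\<in>I. cobd (P i) xs)"
  by (induction xs arbitrary: P) (auto simp: sum_subtractf)

lemma cobd_of_int: "cobd (\<lambda>ys. of_int (P ys)) xs = of_int (cobd P xs)"
  by (induction xs arbitrary: P) auto

lemma cobd_map: "cobd (\<lambda>ys. P (map Y ys)) xs = cobd P (map Y xs)"
proof (induction xs arbitrary: P)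
  case (Cons x xs)
  then show ?case
    using Cons.IH[of "\<lambda>ys. P (Y x # ys)"] by simp
qed auto

lemma cobd_cobd: "cobd (cobd P) xs = 0"
  by (induction xs arbitrary: P) (auto simp: cobd_diff)

lemma cobd_cong:
  assumes "\<And>ys. set ys \<subseteq> set xs \<Longrightarrow> Suc (length ys) = length xs \<Longrightarrow> P ys = Q ys"
  shows "cobd P xs = cobd Q xs"
  using assms
proof (induction xs arbitrary: P Q)
  case (Cons x xs)
  have "cobd (\<lambda>ys. P (x # ys)) xs = cobd (\<lambda>ys. Q (x # ys)) xs"
    by (rule Cons.IH, rule Cons.prems) auto
  moreover have "P xs = Q xs"
    by (rule Cons.prems) auto
  ultimately show ?case by simp
qed auto

lemma cobd_bound:
  fixes P :: "'a list \<Rightarrow> real" and B :: real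
  assumes "\<And>ys. set ys \<subseteq> set xs \<Longrightarrow> Suc (length ys) = length xs \<Longrightarrow> \<bar>P ys\<bar> \<le> B"
  shows "\<bar>cobd P xs\<bar> \<le> length xs * B"
  using assms
proof (induction xs arbitrary: P)
  case (Cons x xs)
  have "\<bar>cobd (\<lambda>ys. P (x # ys)) xs\<bar> \<le> length xs * B"
    by (rule Cons.IH, rule Cons.prems) auto
  moreover have "\<bar>P xs\<bar> \<le> B"
    by (rule Cons.prems) auto
  ultimately show ?case by (simp add: algebra_simps)
qed auto

text \<open>These are the cochains vanishing on the degenerate simplices of the homogeneous bar
  complex. Equal entries further apart do not make a simplex degenerate, so it is neighbouring
  vertices that have to be merged later.\<close>

definition normalized :: "('a list \<Rightarrow> 'b::zero) \<Rightarrow> bool" where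
  "normalized P \<longleftrightarrow> (\<forall>xs. \<not> distinct_adj xs \<longrightarrow> P xs = 0)"

lemma normalized_Cons: "normalized P \<Longrightarrow> normalized (\<lambda>ys. P (x # ys))"
  unfolding normalized_def by (metis distinct_adj_ConsD)

text \<open>Omitting either of two equal neighbours leaves the same list, with opposite signs, and
  every other omission keeps the pair.\<close>

lemma cobd_normalized: "normalized P \<Longrightarrow> normalized (cobd P)"
proof -
  have "cobd P xs = 0" if "normalized P" "\<not> distinct_adj xs" for P :: "'a list \<Rightarrow> 'b" and xs
    using that
  proof (induction xs arbitrary: P)
    case (Cons x xs)
    show ?case
    proof (cases "distinct_adj xs")
      case False
      then show ?thesis
        using Cons.IH[OF normalized_Cons[OF Cons.prems(1)] False] Cons.prems(1)
        by (simp add: normalized_def)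
    next
      case True
      then obtain ys where xs: "xs = x # ys"
        using Cons.prems(2) by (cases xs) (auto simp: distinct_adj_Cons)
      have "(\<lambda>zs. P (x # x # zs)) = (\<lambda>_. 0)"
        using Cons.prems(1) by (auto simp: normalized_def)
      then show ?thesis by (simp add: xs)
    qed
  qed auto
  then show "normalized P \<Longrightarrow> normalized (cobd P)"
    unfolding normalized_def by blast
qed

section \<open>The prism operator as a homotopy between the identity and
  \<open>map Y\<close>\<close>

lemma prism_zero [simp]: "prism Y (\<lambda>_. 0) xs = 0"
  by (induction xs) auto

lemma prism_diff: "prism Y (\<lambda>ys. P ys - Q ys) xs = prism Y P xs - prism Y Q xs"
  by (induction xs arbitrary: P Q) auto

text \<open>This is the triangulation of a simplex times an interval: inner faces of neighbouring
  pieces cancel, and the top \<open>map Y xs\<close> and the bottom \<open>xs\<close>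
  remain.\<close>

lemma prism_homotopy:
  "cobd (prism Y P) xs + prism Y (cobd P) xs = P (map Y xs) - P xs"
proof (induction xs arbitrary: P)
  case (Cons x xs)
  show ?case
    using Cons.IH[of "\<lambda>ys. P (x # ys)"]
    by (simp add: cobd_diff prism_diff cobd_map[of "\<lambda>ys. P (x # Y x # ys)"] algebra_simps)
qed auto

lemma prism_cong:
  assumes "\<And>ys. set ys \<subseteq> set xs \<union> Y ` set xs \<Longrightarrow> length ys = Suc (length xs) \<Longrightarrow> P ys = Q ys"
  shows "prism Y P xs = prism Y Q xs"
  using assms
proof (induction xs arbitrary: P Q)
  case (Cons x xs)
  have "prism Y (\<lambda>ys. P (x # ys)) xs = prism Y (\<lambda>ys. Q (x # ys)) xs"
    by (rule Cons.IH, rule Cons.prems) auto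
  moreover have "P (x # Y x # map Y xs) = Q (x # Y x # map Y xs)"
    by (rule Cons.prems) auto
  ultimately show ?case by simp
qed auto

lemma prism_bound:
  fixes P :: "'a list \<Rightarrow> real" and B :: real
  assumes "\<And>ys. set ys \<subseteq> set xs \<union> Y ` set xs \<Longrightarrow> length ys = Suc (length xs) \<Longrightarrow> \<bar>P ys\<bar> \<le> B"
  shows "\<bar>prism Y P xs\<bar> \<le> length xs * B"
  using assms
proof (induction xs arbitrary: P)
  case (Cons x xs)
  have "\<bar>prism Y (\<lambda>ys. P (x # ys)) xs\<bar> \<le> length xs * B"
    by (rule Cons.IH, rule Cons.prems) auto
  moreover have "\<bar>P (x # Y x # map Y xs)\<bar> \<le> B"
    by (rule Cons.prems) auto
  ultimately show ?case by (simp add: algebra_simps)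
qed auto

text \<open>Every list in the prism contains some \<open>x\<close> directly followed by
  \<open>Y x\<close>.\<close>

lemma prism_fixed:
  assumes "normalized P" "\<And>x. x \<in> set xs \<Longrightarrow> Y x = x"
  shows "prism Y P xs = 0"
  using assms
proof (induction xs arbitrary: P)
  case (Cons x xs)
  then show ?case
    using Cons.IH[OF normalized_Cons[OF Cons.prems(1)]] by (simp add: normalized_def)
qed auto

lemma prism_degenerate:
  assumes "normalized P"
  shows "prism Y P (x # x # xs) = 0"
proof -
  have "(\<lambda>zs. P (x # x # zs)) = (\<lambda>_. 0)" "P (x # Y x # Y x # map Y xs) = 0"
       "P (x # x # Y x # map Y xs) = 0"
    using assms by (auto simp: normalized_def)
  then show ?thesis by simp
qed

section \<open>Random projections in a hyperbolic space\<close>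

text \<open>Assumption \<open>hyp\<close> is Gromov's four-point inequality with constant \<open>e / 2\<close> at the base point, rearranged so
  that no subtraction of natural numbers occurs.\<close>

locale hyperbolic_space =
  fixes X :: "'a set" and base :: 'a and d :: "'a \<Rightarrow> 'a \<Rightarrow> nat" and e :: nat
  assumes base_in: "base \<in> X"
    and d_self: "x \<in> X \<Longrightarrow> d x x = 0"
    and d_zero: "x \<in> X \<Longrightarrow> d base x = 0 \<Longrightarrow> x = base"
    and d_sym: "x \<in> X \<Longrightarrow> y \<in> X \<Longrightarrow> d x y = d y x"
    and d_tri: "x \<in> X \<Longrightarrow> y \<in> X \<Longrightarrow> z \<in> X \<Longrightarrow> d x z \<le> d x y + d y z"
    and hyp: "x \<in> X \<Longrightarrow> y \<in> X \<Longrightarrow> z \<in> X \<Longrightarrow>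
      d x z + d base y \<le> max (d x y + d base z) (d y z + d base x) + e"
    and geodesic: "x \<in> X \<Longrightarrow> m \<le> d base x \<Longrightarrow> \<exists>y\<in>X. d base y = m \<and> d x y = d base x - m"
    and balls: "\<exists>N. \<forall>x\<in>X. finite {y \<in> X. d x y \<le> r} \<and> card {y \<in> X. d x y \<le> r} \<le> N"
begin

text \<open>The argument asks for a step larger than \<open>e\<close>, so that projecting brings
  distant points closer, and at least \<open>3 * e / 2\<close>, so that the shadows in
  \<open>shadow_meet\<close> intersect.\<close>

definition L :: nat where "L = 2 * e + 1"

definition A :: "nat \<Rightarrow> 'a set" where "A J = {x \<in> X. d base x \<le> L * J}"

text \<open>Points of the sphere of radius \<open>L * J\<close> which lie near a geodesic from \<open>x\<close> to the base point.\<close>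

definition shadow :: "nat \<Rightarrow> 'a \<Rightarrow> 'a set" where
  "shadow J x = (if d base x \<le> L * J then {x}
             else {y \<in> X. d base y = L * J \<and> d x y + L * J \<le> d base x + e})"

text \<open>A uniformly random element of this product chooses all shadow points independently.
  Restricting to a ball keeps the product finite, so that probabilities are quotients of
  cardinalities.\<close>

definition projs :: "nat \<Rightarrow> ('a \<Rightarrow> 'a) set" where
  "projs J = PiE (A (Suc J)) (shadow J)"

definition small :: "nat \<Rightarrow> 'a list \<Rightarrow> bool" where
  "small D xs \<longleftrightarrow> (\<forall>x\<in>set xs. \<forall>y\<in>set xs. d x y \<le> D)"

lemma A_subset: "A J \<subseteq> X"
  by (auto simp: A_def)

lemma A_mono: "I \<le> J \<Longrightarrow> A I \<subseteq> A J"
  unfolding A_def by (auto intro: order_trans mult_le_mono2)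

lemma finite_A: "finite (A J)"
  using balls[of "L * J"] base_in by (auto simp: A_def)

lemma A_0: "A 0 = {base}"
  using d_zero base_in d_self by (auto simp: A_def)

lemma shadow_nonempty: "x \<in> X \<Longrightarrow> shadow J x \<noteq> {}"
  using geodesic[of x "L * J"] by (auto simp: shadow_def; force)

lemma shadow_in_A: "x \<in> X \<Longrightarrow> shadow J x \<subseteq> A J"
  by (auto simp: shadow_def A_def)

lemma shadow_dist:
  assumes "x \<in> A (Suc J)" "y \<in> shadow J x"
  shows "d x y \<le> L + e"
  using assms d_self by (auto simp: shadow_def A_def split: if_splits)

lemma finite_shadow: "x \<in> X \<Longrightarrow> finite (shadow J x)"
  using finite_subset[OF shadow_in_A finite_A] .

lemma shadow_card_bound: "\<exists>N>0. \<forall>J. \<forall>x\<in>A (Suc J). card (shadow J x) \<le> N"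
proof -
  obtain N where N: "\<forall>x\<in>X. finite {y \<in> X. d x y \<le> L + e} \<and> card {y \<in> X. d x y \<le> L + e} \<le> N"
    using balls by blast
  have "card (shadow J x) \<le> N" if "x \<in> A (Suc J)" for J x
  proof -
    have x: "x \<in> X" using that A_subset by blast
    have "shadow J x \<subseteq> {y \<in> X. d x y \<le> L + e}"
      using shadow_dist[OF that] shadow_in_A[OF x] A_subset by blast
    then show ?thesis using N x card_mono le_trans by meson
  qed
  then show ?thesis by (intro exI[of _ "Suc N"]) (auto intro: le_SucI)
qed

lemma finite_projs: "finite (projs J)"
  unfolding projs_def using finite_A finite_shadow A_subset by (intro finite_PiE) blast+

lemma projs_nonempty: "projs J \<noteq> {}"
  unfolding projs_def using shadow_nonempty A_subset by (auto simp: PiE_eq_empty_iff)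

lemma card_Om_pos: "card (projs J) > 0"
  using finite_projs projs_nonempty by (simp add: card_gt_0_iff)

lemma projs_shadow: "Y \<in> projs J \<Longrightarrow> x \<in> A (Suc J) \<Longrightarrow> Y x \<in> shadow J x"
  by (auto simp: projs_def)

lemma projs_A: "Y \<in> projs J \<Longrightarrow> x \<in> A (Suc J) \<Longrightarrow> Y x \<in> A J"
  using projs_shadow shadow_in_A A_subset by blast

lemma projs_fixed: "Y \<in> projs J \<Longrightarrow> x \<in> A J \<Longrightarrow> Y x = x"
  using projs_shadow[of Y J x] A_mono[of J "Suc J"] by (auto simp: shadow_def A_def)

lemma projs_dist: "Y \<in> projs J \<Longrightarrow> x \<in> A (Suc J) \<Longrightarrow> d x (Y x) \<le> L + e"
  using projs_shadow shadow_dist by blast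

lemma projs_sphere:
  assumes "Y \<in> projs J" "x \<in> X" "d base x = L * Suc J"
  shows "d base (Y x) = L * J" "Y x \<in> X"
proof -
  have "x \<in> A (Suc J)" using assms by (auto simp: A_def)
  then have "Y x \<in> shadow J x" using projs_shadow assms(1) by blast
  then show "d base (Y x) = L * J" "Y x \<in> X"
    using assms(3) by (auto simp: shadow_def L_def split: if_splits)
qed

text \<open>The four-point inequality for \<open>x, x', y'\<close> bounds \<open>d x y'\<close> by
  the maximum of \<open>d x x' - L + e\<close> and \<open>L + 2 * e\<close>; applied to
  \<open>y, x, y'\<close> it gains another \<open>L\<close>. Close points keep a residue of
  \<open>3 * e\<close>, so distances alone do not force vertices to merge.\<close>

lemma shadow_contract:
  assumes "x \<in> X" "x' \<in> X" "d base x = L * Suc J" "d base x' = L * Suc J"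
    and "y \<in> shadow J x" "y' \<in> shadow J x'"
  shows "d y y' \<le> max (3 * e) (d x x' + 2 * e - 2 * L)"
proof -
  have lt: "\<not> L * Suc J \<le> L * J" by (simp add: L_def)
  have y: "y \<in> X" "d base y = L * J" "d x y \<le> L + e"
    using assms lt by (auto simp: shadow_def)
  have y': "y' \<in> X" "d base y' = L * J" "d x' y' \<le> L + e"
    using assms lt by (auto simp: shadow_def)
  have s: "L * Suc J = L * J + L" by simp
  have "d x y' + d base x' \<le> max (d x x' + d base y') (d x' y' + d base x) + e"
    using hyp[of x x' y'] assms(1,2) y'(1) by blast
  moreover have "d y y' + d base x \<le> max (d y x + d base y') (d x y' + d base y) + e"
    using hyp[of y x y'] assms(1) y(1) y'(1) by blast
  moreover have "d y x = d x y" using d_sym assms(1) y(1) by blast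
  ultimately show ?thesis
    using y y' assms(3,4) L_def unfolding s by linarith
qed

text \<open>The slack \<open>e\<close> in \<open>shadow\<close> is made for this: a point on an
  actual geodesic from \<open>x\<close> misses being on one from a nearby \<open>x'\<close> by at
  most \<open>e\<close>.\<close>

lemma shadow_meet:
  assumes "x \<in> X" "x' \<in> X" "d base x = L * Suc J" "d base x' = L * Suc J" "d x x' \<le> 3 * e"
  obtains y where "y \<in> shadow J x" "y \<in> shadow J x'"
proof -
  have lt: "\<not> L * Suc J \<le> L * J" by (simp add: L_def)
  have s: "L * Suc J = L * J + L" by simp
  obtain y where y: "y \<in> X" "d base y = L * J" "d x y = L"
    using geodesic[of x "L * J"] assms(1,3) by auto
  have "d x' y + d base x \<le> max (d x' x + d base y) (d x y + d base x') + e"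
    using hyp[of x' x y] assms(1,2) y(1) by blast
  moreover have "d x' x = d x x'" using d_sym assms(1,2) by blast
  ultimately have "d x' y \<le> L + e"
    using y assms(3-5) L_def unfolding s by linarith
  then show ?thesis
    using that[of y] y assms(3,4) lt s by (auto simp: shadow_def)
qed

text \<open>Resetting the values at \<open>x\<close> and \<open>x'\<close> to a common point loses at most two coordinates.\<close>

lemma projs_coincide:
  assumes "x \<in> A (Suc J)" "x' \<in> A (Suc J)" "y \<in> shadow J x" "y \<in> shadow J x'"
    and N: "card (shadow J x) \<le> N" "card (shadow J x') \<le> N"
  shows "card (projs J) \<le> card {Y \<in> projs J. Y x = Y x'} * (N * N)"
proof -
  let ?G = "{Y \<in> projs J. Y x = Y x'}"
  let ?f = "\<lambda>Y. (Y(x := y, x' := y), Y x, Y x')"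
  have "inj_on ?f (projs J)"
  proof (rule inj_onI)
    fix Y Z assume "?f Y = ?f Z"
    then show "Y = Z"
      by (metis (no_types, lifting) fun_upd_idem_iff fun_upd_twist fun_upd_upd prod.inject)
  qed
  moreover have "?f ` projs J \<subseteq> ?G \<times> (shadow J x \<times> shadow J x')"
    using assms by (auto simp: projs_def PiE_iff extensional_def)
  moreover have fin: "finite (shadow J x)" "finite (shadow J x')"
    using assms(1,2) A_subset finite_shadow by blast+
  then have "finite (?G \<times> (shadow J x \<times> shadow J x'))"
    using finite_projs by auto
  ultimately have "card (projs J) \<le> card (?G \<times> (shadow J x \<times> shadow J x'))"
    using card_inj_on_le by blast
  also have "\<dots> = card ?G * (card (shadow J x) * card (shadow J x'))"
    by (simp add: card_cartesian_product)
  also have "\<dots> \<le> card ?G * (N * N)"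
    using N by (intro mult_le_mono) auto
  finally show ?thesis .
qed

end

section \<open>Bounded primitives\<close>

text \<open>\<open>Phi\<close> has degree \<open>n\<close>, hence \<open>Suc n\<close> arguments;
  its primitive has \<open>n\<close> arguments, and \<open>n2\<close> provides the two vertices that
  are merged. The bound in \<open>bdd_Phi\<close> may grow with the diameter
  \<open>D\<close>.\<close>

locale hyperbolic_cocycle = hyperbolic_space X base d e
  for X :: "'a set" and base :: 'a and d :: "'a \<Rightarrow> 'a \<Rightarrow> nat" and e :: nat +
  fixes n :: nat and Phi :: "'a list \<Rightarrow> real"
  assumes n2: "n \<ge> 2"
    and norm_Phi: "normalized Phi"
    and cocycle: "set xs \<subseteq> X \<Longrightarrow> length xs = Suc (Suc n) \<Longrightarrow> cobd Phi xs = 0"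
    and bdd_Phi: "\<exists>B. \<forall>xs. set xs \<subseteq> X \<longrightarrow> length xs = Suc n \<longrightarrow> small D xs \<longrightarrow> \<bar>Phi xs\<bar> \<le> B"
begin

text \<open>By \<open>prism_homotopy\<close> and the cocycle equation the prism term has coboundary
  \<open>Phi (map Y xs) - Phi xs\<close>, so subtracting it turns a primitive at the projected
  simplex into one at \<open>xs\<close>. The start is 0 because \<open>A 0\<close> is a single
  point, where every simplex in question is degenerate.\<close>

primrec Psi :: "nat \<Rightarrow> 'a list \<Rightarrow> real" where
  "Psi 0 = (\<lambda>_. 0)"
| "Psi (Suc J) = (\<lambda>xs. (\<Sum>Y\<in>projs J. Psi J (map Y xs) - prism Y Phi xs) / card (projs J))"

lemma cobd_Psi:
  assumes "set xs \<subseteq> A J" "length xs = Suc n"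
  shows "cobd (Psi J) xs = Phi xs"
  using assms
proof (induction J arbitrary: xs)
  case 0
  then obtain x y zs where xs: "xs = x # y # zs"
    using n2 by (cases xs; cases "tl xs") auto
  with 0 have "x = y" by (auto simp: A_0)
  then have "Phi xs = 0"
    using norm_Phi xs by (auto simp: normalized_def)
  then show ?case by simp
next
  case (Suc J)
  have X: "set xs \<subseteq> X" using Suc.prems A_subset by blast
  have *: "cobd (\<lambda>ys. Psi J (map Y ys) - prism Y Phi ys) xs = Phi xs" if Y: "Y \<in> projs J" for Y
  proof -
    have YA: "set (map Y xs) \<subseteq> A J" using projs_A[OF Y] Suc.prems(1) by auto
    have "prism Y (cobd Phi) xs = prism Y (\<lambda>_. 0) xs"
    proof (rule prism_cong)
      fix ys assume "set ys \<subseteq> set xs \<union> Y ` set xs" "length ys = Suc (length xs)"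
      then show "cobd Phi ys = 0"
        using X YA A_subset[of J] Suc.prems(2) by (intro cocycle) (simp, blast, simp)
    qed
    then have "cobd (prism Y Phi) xs = Phi (map Y xs) - Phi xs"
      using prism_homotopy[of Y Phi xs] by simp
    moreover have "cobd (\<lambda>ys. Psi J (map Y ys)) xs = Phi (map Y xs)"
      using Suc.IH[OF YA] Suc.prems(2) by (simp add: cobd_map)
    ultimately show ?thesis by (simp add: cobd_diff)
  qed
  have "cobd (Psi (Suc J)) xs =
      cobd (\<lambda>ys. (1 / card (projs J)) * (\<Sum>Y\<in>projs J. Psi J (map Y ys) - prism Y Phi ys)) xs"
    by simp
  also have "\<dots> = (1 / card (projs J)) * (\<Sum>Y\<in>projs J. cobd (\<lambda>ys. Psi J (map Y ys) - prism Y Phi ys) xs)"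
    by (simp only: cobd_cmult cobd_sum)
  also have "\<dots> = Phi xs"
    using * card_Om_pos[of J] by simp
  finally show ?case .
qed

text \<open>Projections fix the smaller ball, and prisms over fixed vertices are degenerate. Hence
  the levels are compatible and define one cochain on the whole space.\<close>

lemma Psi_Suc:
  assumes "set xs \<subseteq> A J"
  shows "Psi (Suc J) xs = Psi J xs"
proof -
  have "Psi J (map Y xs) - prism Y Phi xs = Psi J xs" if Y: "Y \<in> projs J" for Y
  proof -
    have "map Y xs = xs" using assms projs_fixed[OF Y] by (intro map_idI) auto
    moreover have "prism Y Phi xs = 0"
      using prism_fixed[OF norm_Phi, of xs Y] assms projs_fixed[OF Y] by auto
    ultimately show ?thesis by simp
  qed
  then show ?thesis using card_Om_pos[of J] by simp
qed

lemma Psi_stable: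
  assumes "set xs \<subseteq> A I" "I \<le> J"
  shows "Psi J xs = Psi I xs"
  using assms(2)
proof (induction J rule: dec_induct)
  case (step J)
  then have "set xs \<subseteq> A J" using assms(1) A_mono by blast
  with step Psi_Suc show ?case by simp
qed auto

lemma Psi_degenerate: "Psi J (x # x # xs) = 0"
  by (induction J arbitrary: x xs) (simp_all del: prism.simps add: prism_degenerate[OF norm_Phi])

section \<open>Bounds on \<open>Psi\<close> that are uniform in the level\<close>

lemma prism_bounded:
  "\<exists>B\<ge>0. \<forall>J Y xs. Y \<in> projs J \<longrightarrow> set xs \<subseteq> A (Suc J) \<longrightarrow> length xs = n \<longrightarrow> small D xs \<longrightarrow>
     \<bar>prism Y Phi xs\<bar> \<le> B"
proof -
  \<comment> \<open>Vertices of the prism lie within \<open>L + e\<close> of vertices of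
    \<open>xs\<close>, so the diameter grows by at most twice that, at every level
    \<open>J\<close>.\<close>
  obtain B where B: "\<And>xs. set xs \<subseteq> X \<Longrightarrow> length xs = Suc n \<Longrightarrow> small (D + 2 * (L + e)) xs \<Longrightarrow> \<bar>Phi xs\<bar> \<le> B"
    using bdd_Phi by blast
  have "\<bar>prism Y Phi xs\<bar> \<le> n * \<bar>B\<bar>"
    if Y: "Y \<in> projs J" and xs: "set xs \<subseteq> A (Suc J)" "length xs = n" "small D xs" for J Y xs
  proof -
    have "\<bar>prism Y Phi xs\<bar> \<le> length xs * \<bar>B\<bar>"
    proof (rule prism_bound)
      fix ys assume ys: "set ys \<subseteq> set xs \<union> Y ` set xs" "length ys = Suc (length xs)"
      have near: "\<exists>x\<in>set xs. d x y \<le> L + e \<and> x \<in> X \<and> y \<in> X" if y: "y \<in> set ys" for y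
      proof (cases "y \<in> set xs")
        case True
        moreover have "y \<in> X" using True xs(1) A_subset by blast
        ultimately show ?thesis using d_self by (intro bexI[of _ y]) auto
      next
        case False
        then obtain x where x: "x \<in> set xs" "y = Y x" using y ys(1) by auto
        then show ?thesis
          using projs_dist[OF Y, of x] projs_A[OF Y, of x] xs(1) A_subset by (intro bexI[of _ x]) auto
      qed
      have "small (D + 2 * (L + e)) ys"
        unfolding small_def
      proof (intro ballI)
        fix y z assume "y \<in> set ys" "z \<in> set ys"
        then obtain a b where ab: "a \<in> set xs" "d a y \<le> L + e" "a \<in> X" "y \<in> X"
            "b \<in> set xs" "d b z \<le> L + e" "b \<in> X" "z \<in> X"
          using near by meson
        have "d a b \<le> D" using xs(3) ab by (auto simp: small_def)
        moreover have "d y z \<le> d y a + d a z" "d a z \<le> d a b + d b z" "d y a = d a y"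
          using d_tri[of y a z] d_tri[of a b z] d_sym[of y a] ab by simp_all
        ultimately show "d y z \<le> D + 2 * (L + e)" using ab by simp
      qed
      moreover have "set ys \<subseteq> X" using near by blast
      ultimately have "\<bar>Phi ys\<bar> \<le> B" using B ys xs by simp
      then show "\<bar>Phi ys\<bar> \<le> \<bar>B\<bar>" by simp
    qed
    then show ?thesis using xs by simp
  qed
  then show ?thesis by (intro exI[of _ "n * \<bar>B\<bar>"]) auto
qed

text \<open>The crude estimate, at the price of one prism bound per level. It is applied a number of
  times that depends on the diameter or on the width of an annulus, but not on
  \<open>J\<close>.\<close>

lemma Psi_Suc_bound:
  assumes "\<And>Y. Y \<in> projs J \<Longrightarrow> \<bar>Psi J (map Y xs)\<bar> \<le> M" "\<And>Y. Y \<in> projs J \<Longrightarrow> \<bar>prism Y Phi xs\<bar> \<le> B"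
  shows "\<bar>Psi (Suc J) xs\<bar> \<le> M + B"
proof -
  have "\<bar>\<Sum>Y\<in>projs J. Psi J (map Y xs) - prism Y Phi xs\<bar> \<le> (\<Sum>Y\<in>projs J. M + B)"
  proof (rule order_trans[OF sum_abs], rule sum_mono)
    fix Y assume "Y \<in> projs J"
    then show "\<bar>Psi J (map Y xs) - prism Y Phi xs\<bar> \<le> M + B"
      using assms(1)[of Y] assms(2)[of Y] by linarith
  qed
  then show ?thesis
    using card_Om_pos[of J] by (simp add: divide_le_eq mult.commute)
qed

text \<open>With all vertices on one sphere, a projection moves every vertex to the next sphere
  inwards, and \<open>shadow_contract\<close> applies to every pair.\<close>

definition sphere :: "nat \<Rightarrow> 'a list \<Rightarrow> bool" where
  "sphere J xs \<longleftrightarrow> set xs \<subseteq> X \<and> length xs = n \<and> (\<forall>x\<in>set xs. d base x = L * J)"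

lemma sphere_A: "sphere J xs \<Longrightarrow> set xs \<subseteq> A J"
  by (auto simp: sphere_def A_def)

lemma sphere_map: "sphere (Suc J) xs \<Longrightarrow> Y \<in> projs J \<Longrightarrow> sphere J (map Y xs)"
  using projs_sphere by (auto simp: sphere_def)

lemma sphere_small:
  assumes "sphere (Suc J) xs" "Y \<in> projs J" "small D xs"
  shows "small (max (3 * e) (D + 2 * e - 2 * L)) (map Y xs)"
  unfolding small_def
proof (intro ballI)
  fix y y' assume "y \<in> set (map Y xs)" "y' \<in> set (map Y xs)"
  then obtain x x' where x: "x \<in> set xs" "x' \<in> set xs" "y = Y x" "y' = Y x'" by auto
  have "x \<in> A (Suc J)" "x' \<in> A (Suc J)" using x sphere_A[OF assms(1)] by auto
  then have "y \<in> shadow J x" "y' \<in> shadow J x'" using x projs_shadow assms(2) by auto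
  then have "d y y' \<le> max (3 * e) (d x x' + 2 * e - 2 * L)"
    using assms(1) x by (intro shadow_contract[of x x' J]) (auto simp: sphere_def)
  moreover have "d x x' \<le> D" using assms(3) x by (auto simp: small_def)
  ultimately show "d y y' \<le> max (3 * e) (D + 2 * e - 2 * L)" by linarith
qed

text \<open>Two vertices of a small simplex are projected to the same point with probability at
  least \<open>1 / N\<^sup>2\<close>, and \<open>Psi\<close> vanishes on degenerate simplices; so passing from one sphere to the
  next contracts the supremum of \<open>Psi\<close> by \<open>1 - 1 / N\<^sup>2\<close>, up to the bounded prism term.\<close>

lemma Psi_bounded_sphere_small:
  "\<exists>C. \<forall>J xs. sphere J xs \<longrightarrow> small (3 * e) xs \<longrightarrow> \<bar>Psi J xs\<bar> \<le> C"
proof -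
  obtain N where N: "N > 0" "\<And>J x. x \<in> A (Suc J) \<Longrightarrow> card (shadow J x) \<le> N"
    using shadow_card_bound by blast
  obtain B where B: "B \<ge> 0" "\<And>J Y xs. Y \<in> projs J \<Longrightarrow> set xs \<subseteq> A (Suc J) \<Longrightarrow> length xs = n \<Longrightarrow>
      small (3 * e) xs \<Longrightarrow> \<bar>prism Y Phi xs\<bar> \<le> B"
    using prism_bounded by blast
  \<comment> \<open>The fixed point of the recursion: \<open>(1 - q) * M + B = M\<close> for
    \<open>q = 1 / (N * N)\<close>. The saving on \<open>Good\<close> below exactly pays for the
    prism term.\<close>
  define M where "M = real (N * N) * B"
  have M0: "M \<ge> 0" using B(1) by (simp add: M_def)
  have "\<bar>Psi J xs\<bar> \<le> M" if "sphere J xs" "small (3 * e) xs" for J xs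
    using that
  proof (induction J arbitrary: xs)
    case 0
    then show ?case using M0 by simp
  next
    case (Suc J)
    obtain x x' zs where xs: "xs = x # x' # zs"
      using n2 Suc.prems(1) by (cases xs; cases "tl xs") (auto simp: sphere_def)
    have xX: "x \<in> X" "x' \<in> X" "d base x = L * Suc J" "d base x' = L * Suc J"
      using Suc.prems(1) xs by (auto simp: sphere_def)
    have xA: "x \<in> A (Suc J)" "x' \<in> A (Suc J)" using sphere_A[OF Suc.prems(1)] xs by auto
    have "d x x' \<le> 3 * e" using Suc.prems(2) xs by (auto simp: small_def)
    then obtain y where y: "y \<in> shadow J x" "y \<in> shadow J x'"
      using shadow_meet xX by blast
    define Good where "Good = {Y \<in> projs J. Y x = Y x'}"
    have fin: "finite Good" "Good \<subseteq> projs J" using finite_projs by (auto simp: Good_def)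
    have "card (projs J) \<le> card Good * (N * N)"
      unfolding Good_def using projs_coincide[OF xA y] N(2) xA by blast
    then have "real (card (projs J)) \<le> real (card Good * (N * N))"
      by (simp only: of_nat_le_iff)
    then have G: "card (projs J) * B \<le> card Good * M"
      using mult_right_mono[OF _ B(1), of "card (projs J)" "card Good * (N * N)"] by (simp add: M_def mult.assoc)
    have pr: "\<bar>prism Y Phi xs\<bar> \<le> B" if "Y \<in> projs J" for Y
      using B(2)[OF that sphere_A[OF Suc.prems(1)]] Suc.prems by (auto simp: sphere_def)
    have bad: "\<bar>Psi J (map Y xs)\<bar> \<le> M" if Y: "Y \<in> projs J" for Y
    proof (rule Suc.IH)
      show "sphere J (map Y xs)" using sphere_map Suc.prems(1) Y by blast
      have "max (3 * e) (3 * e + 2 * e - 2 * L) = 3 * e" by (simp add: L_def)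
      then show "small (3 * e) (map Y xs)" using sphere_small[OF Suc.prems(1) Y Suc.prems(2)] by simp
    qed
    have good: "Psi J (map Y xs) = 0" if "Y \<in> Good" for Y
      using that Psi_degenerate by (simp add: Good_def xs)
    have "\<bar>\<Sum>Y\<in>projs J. Psi J (map Y xs) - prism Y Phi xs\<bar> \<le> (\<Sum>Y\<in>projs J. (if Y \<in> Good then 0 else M) + B)"
    proof (rule order_trans[OF sum_abs], rule sum_mono)
      fix Y assume Y: "Y \<in> projs J"
      show "\<bar>Psi J (map Y xs) - prism Y Phi xs\<bar> \<le> (if Y \<in> Good then 0 else M) + B"
        using pr[OF Y] bad[OF Y] good[of Y] by auto
    qed
    also have "\<dots> = (card (projs J) - real (card Good)) * M + card (projs J) * B"
    proof -
      have "(\<Sum>Y\<in>projs J. if Y \<in> Good then 0 else M) = (\<Sum>Y\<in>projs J - Good. M)"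
        using finite_projs by (intro sum.mono_neutral_cong_right) auto
      also have "\<dots> = (card (projs J) - real (card Good)) * M"
        using fin card_mono[OF finite_projs fin(2)] by (simp add: card_Diff_subset of_nat_diff)
      finally show ?thesis by (simp add: sum.distrib)
    qed
    also have "\<dots> \<le> card (projs J) * M" using G by (simp add: algebra_simps)
    finally show ?case
      using card_Om_pos[of J] by (simp add: divide_le_eq mult.commute)
  qed
  then show ?thesis by blast
qed

text \<open>As \<open>L > e\<close>, each projection lowers the excess of the diameter over
  \<open>3 * e\<close> by at least one. After at most \<open>D\<close> projections the simplex is
  small enough for \<open>Psi_bounded_sphere_small\<close>, unless level 0 is reached earlier, where
  \<open>Psi\<close> is 0.\<close>

lemma Psi_bounded_sphere:
  "\<exists>C. \<forall>J xs. sphere J xs \<longrightarrow> small D xs \<longrightarrow> \<bar>Psi J xs\<bar> \<le> C"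
proof -
  have "\<exists>C. \<forall>J xs. sphere J xs \<longrightarrow> small (3 * e + D) xs \<longrightarrow> \<bar>Psi J xs\<bar> \<le> C"
  proof (induction D)
    case 0
    then show ?case using Psi_bounded_sphere_small by simp
  next
    case (Suc D)
    then obtain C where C: "\<And>J xs. sphere J xs \<Longrightarrow> small (3 * e + D) xs \<Longrightarrow> \<bar>Psi J xs\<bar> \<le> C"
      by blast
    obtain B where B: "B \<ge> 0" "\<And>J Y xs. Y \<in> projs J \<Longrightarrow> set xs \<subseteq> A (Suc J) \<Longrightarrow> length xs = n \<Longrightarrow>
        small (3 * e + Suc D) xs \<Longrightarrow> \<bar>prism Y Phi xs\<bar> \<le> B"
      using prism_bounded by blast
    have "\<bar>Psi J xs\<bar> \<le> \<bar>C\<bar> + B" if xs: "sphere J xs" "small (3 * e + Suc D) xs" for J xs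
    proof (cases J)
      case 0
      then show ?thesis using B(1) by simp
    next
      case (Suc I)
      show ?thesis
        unfolding Suc
      proof (rule Psi_Suc_bound)
        fix Y assume Y: "Y \<in> projs I"
        show "\<bar>prism Y Phi xs\<bar> \<le> B"
          using B(2)[OF Y] xs sphere_A Suc by (auto simp: sphere_def)
        have "max (3 * e) (3 * e + Suc D + 2 * e - 2 * L) \<le> 3 * e + D" by (simp add: L_def)
        then have "small (3 * e + D) (map Y xs)"
          using sphere_small[OF xs(1)[unfolded Suc] Y xs(2)] unfolding small_def by (meson le_trans)
        then have "\<bar>Psi I (map Y xs)\<bar> \<le> C" using C sphere_map Y xs(1) Suc by blast
        then show "\<bar>Psi I (map Y xs)\<bar> \<le> \<bar>C\<bar>" by simp
      qed
    qed
    then show ?case by blast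
  qed
  then obtain C where C: "\<And>J xs. sphere J xs \<Longrightarrow> small (3 * e + D) xs \<Longrightarrow> \<bar>Psi J xs\<bar> \<le> C"
    by blast
  moreover have "small (3 * e + D) xs" if "small D xs" for xs
    using that unfolding small_def by (meson le_add2 le_trans)
  ultimately show ?thesis by blast
qed

text \<open>\<open>k\<close> counts the bands of width \<open>L\<close> below the outer sphere that
  may contain vertices. A projection moves the outermost band onto its inner sphere and fixes the
  rest, which uses up one band; for \<open>k = 0\<close> all vertices are on one sphere. The
  diameter grows meanwhile, so \<open>D\<close> must vary in the induction.\<close>

lemma Psi_bounded_annulus:
  "\<exists>C. \<forall>J xs. set xs \<subseteq> A J \<longrightarrow> length xs = n \<longrightarrow> small D xs \<longrightarrow>
     (\<forall>x\<in>set xs. L * J \<le> d base x + L * k) \<longrightarrow> \<bar>Psi J xs\<bar> \<le> C"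
proof (induction k arbitrary: D)
  case 0
  obtain C where C: "\<And>J xs. sphere J xs \<Longrightarrow> small D xs \<Longrightarrow> \<bar>Psi J xs\<bar> \<le> C"
    using Psi_bounded_sphere by blast
  have "\<bar>Psi J xs\<bar> \<le> C" if "set xs \<subseteq> A J" "length xs = n" "small D xs"
    "\<forall>x\<in>set xs. L * J \<le> d base x + L * 0" for J xs
  proof (rule C)
    show "sphere J xs" using that by (auto simp: sphere_def A_def intro!: antisym)
  qed fact
  then show ?case by blast
next
  case (Suc k)
  then obtain C where C: "\<And>J xs. set xs \<subseteq> A J \<Longrightarrow> length xs = n \<Longrightarrow> small (D + 2 * (L + e)) xs \<Longrightarrow>
      (\<forall>x\<in>set xs. L * J \<le> d base x + L * k) \<Longrightarrow> \<bar>Psi J xs\<bar> \<le> C"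
    by blast
  obtain B where B: "B \<ge> 0" "\<And>J Y xs. Y \<in> projs J \<Longrightarrow> set xs \<subseteq> A (Suc J) \<Longrightarrow> length xs = n \<Longrightarrow>
      small D xs \<Longrightarrow> \<bar>prism Y Phi xs\<bar> \<le> B"
    using prism_bounded by blast
  have "\<bar>Psi J xs\<bar> \<le> \<bar>C\<bar> + B" if xs: "set xs \<subseteq> A J" "length xs = n" "small D xs"
    "\<forall>x\<in>set xs. L * J \<le> d base x + L * Suc k" for J xs
  proof (cases J)
    case 0
    then show ?thesis using B(1) by simp
  next
    case (Suc I)
    show ?thesis
      unfolding Suc
    proof (rule Psi_Suc_bound)
      fix Y assume Y: "Y \<in> projs I"
      show "\<bar>prism Y Phi xs\<bar> \<le> B"
        using B(2)[OF Y] xs Suc by auto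
      have "\<bar>Psi I (map Y xs)\<bar> \<le> C"
      proof (rule C)
        show "set (map Y xs) \<subseteq> A I" using projs_A[OF Y] xs(1) Suc by auto
        show "length (map Y xs) = n" using xs by simp
        show "small (D + 2 * (L + e)) (map Y xs)"
          unfolding small_def
        proof (intro ballI)
          fix y y' assume "y \<in> set (map Y xs)" "y' \<in> set (map Y xs)"
          then obtain x x' where x: "x \<in> set xs" "x' \<in> set xs" "y = Y x" "y' = Y x'" by auto
          then have xA: "x \<in> A (Suc I)" "x' \<in> A (Suc I)" using xs(1) Suc by auto
          then have D: "d x y \<le> L + e" "d x' y' \<le> L + e" using projs_dist[OF Y] x by auto
          have X: "x \<in> X" "x' \<in> X" "y \<in> X" "y' \<in> X"
            using xA projs_A[OF Y] x A_subset by blast+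
          have "d x x' \<le> D" using xs(3) x by (auto simp: small_def)
          moreover have "d y y' \<le> d y x + d x y'" "d x y' \<le> d x x' + d x' y'" "d y x = d x y"
            using d_tri[of y x y'] d_tri[of x x' y'] d_sym[of y x] X by simp_all
          ultimately show "d y y' \<le> D + 2 * (L + e)" using D by simp
        qed
        show "\<forall>y\<in>set (map Y xs). L * I \<le> d base y + L * k"
        proof
          fix y assume "y \<in> set (map Y xs)"
          then obtain x where x: "x \<in> set xs" "y = Y x" by auto
          then have "y \<in> shadow I x" using projs_shadow[OF Y] xs(1) Suc by auto
          moreover have "L * Suc I \<le> d base x + L * Suc k" using xs(4) x Suc by auto
          ultimately show "L * I \<le> d base y + L * k"
            by (auto simp: shadow_def split: if_splits)
        qed
      qed
      then show "\<bar>Psi I (map Y xs)\<bar> \<le> \<bar>C\<bar>" by simp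
    qed
  qed
  then show ?case by blast
qed

section \<open>The limit over all balls, and integrality\<close>

lemma A_exhausts:
  assumes "set xs \<subseteq> X"
  shows "\<exists>J. set xs \<subseteq> A J"
proof -
  have "x \<in> A (sum_list (map (d base) xs))" if "x \<in> set xs" for x
  proof -
    have "d base x \<le> sum_list (map (d base) xs)"
      using that by (intro member_le_sum_list) auto
    also have "\<dots> \<le> L * sum_list (map (d base) xs)" by (simp add: L_def)
    finally show ?thesis using that assms by (auto simp: A_def)
  qed
  then show ?thesis by blast
qed

theorem bounded_primitive:
  "\<exists>Q. (\<forall>xs. set xs \<subseteq> X \<longrightarrow> length xs = Suc n \<longrightarrow> cobd Q xs = Phi xs) \<and>
     (\<forall>D. \<exists>B. \<forall>xs. set xs \<subseteq> X \<longrightarrow> length xs = n \<longrightarrow> small D xs \<longrightarrow> \<bar>Q xs\<bar> \<le> B)"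
proof -
  define lev where "lev xs = (LEAST J. set xs \<subseteq> A J)" for xs
  define Q where "Q xs = Psi (lev xs) xs" for xs
  have lev: "set xs \<subseteq> A (lev xs)" if "set xs \<subseteq> X" for xs
    unfolding lev_def using LeastI_ex[OF A_exhausts[OF that]] .
  have Q: "Q xs = Psi J xs" if "set xs \<subseteq> A J" for xs J
    using that lev[of xs] A_subset[of J] Psi_stable[of xs "lev xs" J]
    by (simp add: Q_def lev_def Least_le)
  have "cobd Q xs = Phi xs" if xs: "set xs \<subseteq> X" "length xs = Suc n" for xs
  proof -
    obtain J where J: "set xs \<subseteq> A J" using A_exhausts xs(1) by blast
    have "cobd Q xs = cobd (Psi J) xs"
      by (rule cobd_cong, rule Q) (use J in auto)
    then show ?thesis using cobd_Psi[OF J xs(2)] by simp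
  qed
  moreover have "\<exists>B. \<forall>xs. set xs \<subseteq> X \<longrightarrow> length xs = n \<longrightarrow> small D xs \<longrightarrow> \<bar>Q xs\<bar> \<le> B" for D
  proof -
    \<comment> \<open>By minimality of the level some vertex lies outside the previous ball. The
      others are within \<open>D \<le> L * D\<close> of it, so \<open>Suc D\<close> bands contain
      them all.\<close>
    obtain C where C: "\<And>J xs. set xs \<subseteq> A J \<Longrightarrow> length xs = n \<Longrightarrow> small D xs \<Longrightarrow>
        (\<forall>x\<in>set xs. L * J \<le> d base x + L * Suc D) \<Longrightarrow> \<bar>Psi J xs\<bar> \<le> C"
      using Psi_bounded_annulus by blast
    have "\<bar>Q xs\<bar> \<le> \<bar>C\<bar>" if xs: "set xs \<subseteq> X" "length xs = n" "small D xs" for xs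
    proof (cases "lev xs")
      case 0
      then show ?thesis by (simp add: Q_def)
    next
      case (Suc I)
      then have "\<not> set xs \<subseteq> A I" using not_less_Least[of I "\<lambda>J. set xs \<subseteq> A J"] by (simp add: lev_def)
      then obtain x where x: "x \<in> set xs" "d base x > L * I" "x \<in> X"
        using xs(1) by (fastforce simp: A_def)
      have "L * lev xs \<le> d base y + L * Suc D" if y: "y \<in> set xs" for y
      proof -
        have "d base x \<le> d base y + d y x" "d y x \<le> D"
          using d_tri[of base y x] base_in x y xs by (auto simp: small_def)
        moreover have "D \<le> L * D" by (simp add: L_def)
        moreover have "L * lev xs = L * I + L" "L * Suc D = L * D + L" using Suc by simp_all
        ultimately show ?thesis using x(2) by linarith
      qed
      then have "\<bar>Q xs\<bar> \<le> C" using C lev xs by (simp add: Q_def)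
      then show ?thesis by simp
    qed
    then show ?thesis by blast
  qed
  ultimately show ?thesis by blast
qed

text \<open>A real primitive \<open>Q\<close> of an integral cocycle satisfies \<open>Q = Phi(base, \<cdot>) + cobd (Q(base, \<cdot>))\<close>;
  rounding \<open>Q(base, \<cdot>)\<close> makes the right-hand side integral and changes it by a bounded amount.\<close>

theorem bounded_primitive_int:
  assumes Phi: "Phi = (\<lambda>xs. of_int (F xs))"
  shows "\<exists>Q :: 'a list \<Rightarrow> int. (\<forall>xs. set xs \<subseteq> X \<longrightarrow> length xs = Suc n \<longrightarrow> cobd Q xs = F xs) \<and>
     (\<forall>D. \<exists>B. \<forall>xs. set xs \<subseteq> X \<longrightarrow> length xs = n \<longrightarrow> small D xs \<longrightarrow> \<bar>Q xs\<bar> \<le> B)"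
proof -
  obtain R where R: "\<And>xs. set xs \<subseteq> X \<Longrightarrow> length xs = Suc n \<Longrightarrow> cobd R xs = Phi xs"
    "\<And>D. \<exists>B. \<forall>xs. set xs \<subseteq> X \<longrightarrow> length xs = n \<longrightarrow> small D xs \<longrightarrow> \<bar>R xs\<bar> \<le> B"
    using bounded_primitive by blast
  define P where "P ys = \<lfloor>R (base # ys)\<rfloor>" for ys
  define Q where "Q xs = F (base # xs) + cobd P xs" for xs
  have "cobd Q xs = F xs" if xs: "set xs \<subseteq> X" "length xs = Suc n" for xs
  proof -
    \<comment> \<open>On the cone the cocycle equation reads
      \<open>F xs = cobd (\<lambda>ys. F (base # ys)) xs\<close>, so the first summand of
      \<open>Q\<close> is already a primitive, and \<open>cobd P\<close> is there to make it
      bounded.\<close>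
    have "cobd Phi (base # xs) = 0" using cocycle[of "base # xs"] xs base_in by simp
    then have "cobd F (base # xs) = 0" unfolding Phi cobd_of_int by simp
    then show ?thesis
      unfolding Q_def by (simp add: cobd_add cobd_cobd)
  qed
  moreover have "\<exists>B. \<forall>xs. set xs \<subseteq> X \<longrightarrow> length xs = n \<longrightarrow> small D xs \<longrightarrow> \<bar>Q xs\<bar> \<le> B" for D
  proof -
    obtain B where B: "\<And>xs. set xs \<subseteq> X \<Longrightarrow> length xs = n \<Longrightarrow> small D xs \<Longrightarrow> \<bar>R xs\<bar> \<le> B"
      using R(2) by blast
    have "\<bar>Q xs\<bar> \<le> \<lceil>B + n\<rceil>" if xs: "set xs \<subseteq> X" "length xs = n" "small D xs" for xs
    proof -
      have "R xs = Phi (base # xs) + cobd (\<lambda>ys. R (base # ys)) xs"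
        using R(1)[of "base # xs"] xs base_in by simp
      moreover have "real_of_int (Q xs) = Phi (base # xs) + cobd (\<lambda>ys. real_of_int (P ys)) xs"
        by (simp add: Q_def Phi cobd_of_int)
      ultimately have "real_of_int (Q xs) = R xs - cobd (\<lambda>ys. frac (R (base # ys))) xs"
        \<comment> \<open>\<open>R\<close> and \<open>Q\<close> differ by the coboundary of
          fractional parts; these are below 1 on each of the \<open>n\<close> faces, hence the extra
          \<open>n\<close> in the bound.\<close>
        by (simp add: frac_def P_def cobd_diff)
      moreover have "\<bar>cobd (\<lambda>ys. frac (R (base # ys))) xs\<bar> \<le> length xs * (1::real)"
        by (rule cobd_bound) (auto simp: frac_lt_1 less_imp_le)
      ultimately have "\<bar>real_of_int (Q xs)\<bar> \<le> B + n"
        using B[OF xs] xs(2) by simp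
      then show ?thesis by linarith
    qed
    then show ?thesis by blast
  qed
  ultimately show ?thesis by blast
qed

end

section \<open>Word metrics\<close>

lemma (in group) inv_mult_cancel:
  assumes "g \<in> carrier G" "y \<in> carrier G"
  shows "inv g \<otimes> (g \<otimes> y) = y" "g \<otimes> (inv g \<otimes> y) = y"
  using assms by (simp_all add: m_assoc[symmetric])

locale word_metric = group G for G :: "'g monoid" (structure) +
  fixes S :: "'g set"
  assumes finite_S: "finite S" and S_carrier: "S \<subseteq> carrier G" and gen: "generate G S = carrier G"
begin

abbreviation T :: "'g set" where "T \<equiv> S \<union> m_inv G ` S"

definition eval_word :: "'g list \<Rightarrow> 'g" where "eval_word ws = foldr (\<otimes>) ws \<one>"

lemma eval_word_simps [simp]: "eval_word [] = \<one>" "eval_word (w # ws) = w \<otimes> eval_word ws"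
  by (simp_all add: eval_word_def)

abbreviation wl :: "'g \<Rightarrow> nat" where "wl \<equiv> word_length G S"

definition wd :: "'g \<Rightarrow> 'g \<Rightarrow> nat" where "wd x y = wl (inv x \<otimes> y)"

lemma T_carrier: "T \<subseteq> carrier G"
  using S_carrier by auto

lemma T_inv: "t \<in> T \<Longrightarrow> inv t \<in> T"
  using S_carrier by auto

lemma T_inv_list: "set ws \<subseteq> T \<Longrightarrow> set (rev (map (m_inv G) ws)) \<subseteq> T"
  using T_inv by (simp only: set_rev set_map image_subset_iff subset_iff simp_thms) blast

lemma eval_word_closed: "set ws \<subseteq> T \<Longrightarrow> eval_word ws \<in> carrier G"
  using T_carrier by (induction ws) auto

lemma eval_word_append:
  "set vs \<subseteq> T \<Longrightarrow> set ws \<subseteq> T \<Longrightarrow> eval_word (vs @ ws) = eval_word vs \<otimes> eval_word ws"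
proof (induction vs)
  case Nil
  then show ?case using eval_word_closed by simp
next
  case (Cons v vs)
  moreover have "v \<in> carrier G" using Cons.prems T_carrier by auto
  ultimately show ?case using eval_word_closed by (simp add: m_assoc)
qed

lemma eval_word_inverse: "set ws \<subseteq> T \<Longrightarrow> eval_word (rev (map (m_inv G) ws)) = inv (eval_word ws)"
proof (induction ws)
  case (Cons w ws)
  have w: "w \<in> carrier G" "inv w \<in> T" using Cons.prems T_carrier T_inv by auto
  have "set (rev (map (m_inv G) ws)) \<subseteq> T" using Cons.prems by (intro T_inv_list) auto
  then have "eval_word (rev (map (m_inv G) ws) @ [inv w]) = eval_word (rev (map (m_inv G) ws)) \<otimes> eval_word [inv w]"
    using w by (intro eval_word_append) auto
  then show ?case
    using Cons w eval_word_closed[of ws] by (simp add: inv_mult_group)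
qed auto

lemma word_exists: "x \<in> carrier G \<Longrightarrow> \<exists>ws. set ws \<subseteq> T \<and> eval_word ws = x"
  unfolding gen[symmetric]
proof (induction rule: generate.induct)
  case one
  show ?case by (intro exI[of _ "[]"]) auto
next
  case (incl h)
  then show ?case using S_carrier by (intro exI[of _ "[h]"]) auto
next
  case (inv h)
  then show ?case using S_carrier by (intro exI[of _ "[inv h]"]) auto
next
  case (eng h1 h2)
  then obtain vs ws where "set vs \<subseteq> T" "eval_word vs = h1" "set ws \<subseteq> T" "eval_word ws = h2" by blast
  then show ?case using eval_word_append by (intro exI[of _ "vs @ ws"]) auto
qed

lemma shortest_word:
  assumes "x \<in> carrier G"
  obtains ws where "length ws = wl x" "set ws \<subseteq> T" "eval_word ws = x"
proof -
  have "\<exists>n ws. length ws = n \<and> set ws \<subseteq> T \<and> eval_word ws = x"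
    using word_exists[OF assms] by blast
  from LeastI_ex[OF this] show ?thesis
    using that unfolding word_length_def eval_word_def by blast
qed

lemma wl_le: "set ws \<subseteq> T \<Longrightarrow> wl (eval_word ws) \<le> length ws"
  unfolding word_length_def eval_word_def by (rule Least_le) blast

lemma wl_one: "wl \<one> = 0"
  using wl_le[of "[]"] by simp

lemma wl_zero: "x \<in> carrier G \<Longrightarrow> wl x = 0 \<Longrightarrow> x = \<one>"
  by (erule shortest_word) auto

lemma wl_mult:
  assumes "x \<in> carrier G" "y \<in> carrier G"
  shows "wl (x \<otimes> y) \<le> wl x + wl y"
proof -
  obtain vs where vs: "length vs = wl x" "set vs \<subseteq> T" "eval_word vs = x" using shortest_word assms by blast
  obtain ws where ws: "length ws = wl y" "set ws \<subseteq> T" "eval_word ws = y" using shortest_word assms by blast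
  show ?thesis using wl_le[of "vs @ ws"] eval_word_append vs ws by simp
qed

lemma wl_inv:
  assumes "x \<in> carrier G"
  shows "wl (inv x) = wl x"
proof -
  have *: "wl (inv x) \<le> wl x" if x: "x \<in> carrier G" for x
  proof -
    obtain vs where vs: "length vs = wl x" "set vs \<subseteq> T" "eval_word vs = x" using shortest_word x by blast
    from wl_le[OF T_inv_list[OF vs(2)]] show ?thesis using eval_word_inverse vs by simp
  qed
  show ?thesis using *[OF assms] *[of "inv x"] assms by simp
qed

lemma finite_wl_ball: "finite {x \<in> carrier G. wl x \<le> r}"
proof (rule finite_subset)
  show "{x \<in> carrier G. wl x \<le> r} \<subseteq> eval_word ` {ws. set ws \<subseteq> T \<and> length ws \<le> r}"
  proof
    fix x assume x: "x \<in> {x \<in> carrier G. wl x \<le> r}"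
    then obtain ws where "length ws = wl x" "set ws \<subseteq> T" "eval_word ws = x" using shortest_word by blast
    then show "x \<in> eval_word ` {ws. set ws \<subseteq> T \<and> length ws \<le> r}" using x by force
  qed
  show "finite (eval_word ` {ws. set ws \<subseteq> T \<and> length ws \<le> r})"
    using finite_S by (intro finite_imageI finite_lists_length_le) auto
qed

lemma wd_left_invariant:
  "g \<in> carrier G \<Longrightarrow> x \<in> carrier G \<Longrightarrow> y \<in> carrier G \<Longrightarrow> wd (g \<otimes> x) (g \<otimes> y) = wd x y"
  by (simp add: wd_def inv_mult_group m_assoc inv_mult_cancel)

lemma wd_one: "x \<in> carrier G \<Longrightarrow> wd \<one> x = wl x"
  by (simp add: wd_def)

text \<open>A shortest word is cut after \<open>m\<close> letters. Both pieces are again shortest,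
  since a shorter replacement of either would shorten the whole word.\<close>

lemma wl_geodesic:
  assumes "x \<in> carrier G" "m \<le> wl x"
  shows "\<exists>y\<in>carrier G. wl y = m \<and> wd x y = wl x - m"
proof -
  obtain ws where ws: "length ws = wl x" "set ws \<subseteq> T" "eval_word ws = x" using shortest_word assms by blast
  define y z where "y = eval_word (take m ws)" and "z = eval_word (drop m ws)"
  have sub: "set (take m ws) \<subseteq> T" "set (drop m ws) \<subseteq> T"
    using ws(2) set_take_subset set_drop_subset by fastforce+
  have c: "y \<in> carrier G" "z \<in> carrier G" using sub eval_word_closed by (auto simp: y_def z_def)
  have x: "x = y \<otimes> z" using eval_word_append[OF sub] ws(3) by (simp add: y_def z_def)
  have y: "wl y \<le> m" using wl_le[OF sub(1)] assms(2) ws by (simp add: y_def)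
  have z: "wl z \<le> wl x - m" using wl_le[OF sub(2)] ws by (simp add: z_def)
  have "wl x \<le> wl y + wl z" using wl_mult c x by simp
  then have *: "wl y = m" "wl z = wl x - m" using y z assms(2) by auto
  have "inv x \<otimes> y = inv z" using c x by (simp add: inv_mult_group m_assoc inv_mult_cancel)
  then have "wd x y = wl z" using c by (simp add: wd_def wl_inv)
  then show ?thesis using c * by (intro bexI[of _ y]) simp_all
qed

lemma wd_sym: "x \<in> carrier G \<Longrightarrow> y \<in> carrier G \<Longrightarrow> wd x y = wd y x"
  using wl_inv[of "inv x \<otimes> y"] by (simp add: wd_def inv_mult_group)

lemma wd_triangle:
  assumes "x \<in> carrier G" "y \<in> carrier G" "z \<in> carrier G"
  shows "wd x z \<le> wd x y + wd y z"
proof -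
  have "inv x \<otimes> z = (inv x \<otimes> y) \<otimes> (inv y \<otimes> z)"
    using assms by (simp add: m_assoc inv_mult_cancel)
  then show ?thesis using wl_mult assms by (simp add: wd_def)
qed

text \<open>Left translation by \<open>x\<close> carries the ball around \<open>\<one>\<close> to
  the ball around \<open>x\<close>, so the bound does not depend on the centre.\<close>

lemma wd_balls:
  assumes "x \<in> carrier G"
  shows "finite {y \<in> carrier G. wd x y \<le> r}"
    and "card {y \<in> carrier G. wd x y \<le> r} \<le> card {y \<in> carrier G. wl y \<le> r}"
proof -
  have sub: "{y \<in> carrier G. wd x y \<le> r} \<subseteq> (\<otimes>) x ` {y \<in> carrier G. wl y \<le> r}"
  proof
    fix y assume y: "y \<in> {y \<in> carrier G. wd x y \<le> r}"
    then have "y = x \<otimes> (inv x \<otimes> y)" using assms by (simp add: inv_mult_cancel)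
    then show "y \<in> (\<otimes>) x ` {y \<in> carrier G. wl y \<le> r}" using y assms by (auto simp: wd_def)
  qed
  show "finite {y \<in> carrier G. wd x y \<le> r}"
    using finite_subset[OF sub finite_imageI[OF finite_wl_ball]] .
  show "card {y \<in> carrier G. wd x y \<le> r} \<le> card {y \<in> carrier G. wl y \<le> r}"
    using card_mono[OF finite_imageI[OF finite_wl_ball] sub] card_image_le[OF finite_wl_ball] le_trans by blast
qed

text \<open>Take \<open>w = \<one>\<close> and move all negative distances to the other side. The
  factor 2 undoes the halves in the Gromov product; rounding up makes the constant a natural
  number.\<close>

lemma hyperbolic_space_wd:
  assumes "\<delta> \<ge> 0"
    and "\<forall>w\<in>carrier G. \<forall>x\<in>carrier G. \<forall>y\<in>carrier G. \<forall>z\<in>carrier G.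
           gromov_product G S w x z \<ge>
             min (gromov_product G S w x y) (gromov_product G S w y z) - \<delta>"
  shows "hyperbolic_space (carrier G) \<one> wd (nat \<lceil>2 * \<delta>\<rceil>)"
proof
  fix x y z assume c: "x \<in> carrier G" "y \<in> carrier G" "z \<in> carrier G"
  have wd: "word_dist G S u v = real (wd u v)" for u v
    by (simp add: word_dist_def wd_def)
  have "gromov_product G S \<one> x z \<ge> min (gromov_product G S \<one> x y) (gromov_product G S \<one> y z) - \<delta>"
    using assms(2) c by simp
  then have "real (wd x z) + real (wd \<one> y) \<le> max (real (wd x y) + real (wd \<one> z)) (real (wd y z) + real (wd \<one> x)) + 2 * \<delta>"
    unfolding gromov_product_def wd wd_sym[OF c(1) one_closed] wd_sym[OF c(2) one_closed]
      wd_sym[OF c(3) one_closed] add_divide_distrib diff_divide_distrib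
    by linarith
  moreover have "2 * \<delta> \<le> real (nat \<lceil>2 * \<delta>\<rceil>)" using assms(1) by linarith
  ultimately have "real (wd x z + wd \<one> y) \<le> real (max (wd x y + wd \<one> z) (wd y z + wd \<one> x) + nat \<lceil>2 * \<delta>\<rceil>)"
    by (simp add: of_nat_max)
  then show "wd x z + wd \<one> y \<le> max (wd x y + wd \<one> z) (wd y z + wd \<one> x) + nat \<lceil>2 * \<delta>\<rceil>"
    by (simp only: of_nat_le_iff)
next
  fix r show "\<exists>N. \<forall>x\<in>carrier G. finite {y \<in> carrier G. wd x y \<le> r} \<and> card {y \<in> carrier G. wd x y \<le> r} \<le> N"
    using wd_balls by blast
next
  fix x m assume "x \<in> carrier G" "m \<le> wd \<one> x"
  then show "\<exists>y\<in>carrier G. wd \<one> y = m \<and> wd x y = wd \<one> x - m"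
    using wl_geodesic[of x m] wd_one by auto
next
  show "wd x y = wd y x" if "x \<in> carrier G" "y \<in> carrier G" for x y
    using that by (rule wd_sym)
next
  show "x = \<one>" if "x \<in> carrier G" "wd \<one> x = 0" for x
    using that wl_zero wd_one by simp
qed (simp_all add: wd_triangle, simp add: wd_def wl_one)

end

section \<open>Chains and cochains on cells\<close>

text \<open>Evaluation of a cochain on a chain. \<open>aug\<close>, \<open>bdry\<close> and
  \<open>coboundary\<close> are all instances, so linearity is proved once, here.\<close>

definition pair :: "('c \<Rightarrow> int) \<Rightarrow> ('c \<Rightarrow> int) \<Rightarrow> int" where
  "pair \<phi> f = (\<Sum>c\<in>{c. f c \<noteq> 0}. f c * \<phi> c)"

lemma pair_superset:
  assumes "finite A" "{c. f c \<noteq> 0} \<subseteq> A"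
  shows "pair \<phi> f = (\<Sum>c\<in>A. f c * \<phi> c)"
  unfolding pair_def using assms by (intro sum.mono_neutral_left) auto

lemma pair_zero [simp]: "pair \<phi> (\<lambda>_. 0) = 0" "pair (\<lambda>_. 0) f = 0"
  by (simp_all add: pair_def)

lemma pair_diff:
  assumes "finite {c. f c \<noteq> 0}" "finite {c. g c \<noteq> 0}"
  shows "pair \<phi> (\<lambda>c. f c - g c) = pair \<phi> f - pair \<phi> g"
proof -
  let ?A = "{c. f c \<noteq> 0} \<union> {c. g c \<noteq> 0}"
  have "finite ?A" using assms by simp
  then show ?thesis
    by (subst (1 2 3) pair_superset[of ?A]) (auto simp: algebra_simps sum_subtractf)
qed

lemma pair_lincomb:
  assumes "finite {c. f c \<noteq> 0}" "finite {c. g c \<noteq> 0}"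
  shows "pair \<phi> (\<lambda>c. a * f c + g c) = a * pair \<phi> f + pair \<phi> g"
proof -
  let ?A = "{c. f c \<noteq> 0} \<union> {c. g c \<noteq> 0}"
  have "finite ?A" using assms by simp
  then show ?thesis
    by (subst (1 2 3) pair_superset[of ?A]) (auto simp: algebra_simps sum.distrib sum_distrib_left)
qed

lemma pair_sum:
  assumes "finite I" "\<And>i. i \<in> I \<Longrightarrow> finite {c. F i c \<noteq> 0}"
  shows "finite {c. (\<Sum>i\<in>I. a i * F i c) \<noteq> 0}"
    and "pair \<phi> (\<lambda>c. \<Sum>i\<in>I. a i * F i c) = (\<Sum>i\<in>I. a i * pair \<phi> (F i))"
proof -
  have "finite {c. (\<Sum>i\<in>I. a i * F i c) \<noteq> 0} \<and>
    pair \<phi> (\<lambda>c. \<Sum>i\<in>I. a i * F i c) = (\<Sum>i\<in>I. a i * pair \<phi> (F i))"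
    using assms
  proof (induction I)
    case (insert i I)
    have fin: "finite {c. F i c \<noteq> 0}" "finite {c. (\<Sum>i\<in>I. a i * F i c) \<noteq> 0}"
      using insert by auto
    have "finite {c. a i * F i c + (\<Sum>i\<in>I. a i * F i c) \<noteq> 0}"
      by (rule finite_subset[OF _ finite_UnI[OF fin]]) auto
    then show ?case
      using insert pair_lincomb[OF fin] by simp
  qed auto
  then show "finite {c. (\<Sum>i\<in>I. a i * F i c) \<noteq> 0}"
    and "pair \<phi> (\<lambda>c. \<Sum>i\<in>I. a i * F i c) = (\<Sum>i\<in>I. a i * pair \<phi> (F i))"
    by auto
qed

lemma pair_diff_left: "pair (\<lambda>c. \<phi> c - \<psi> c) f = pair \<phi> f - pair \<psi> f"
  by (simp add: pair_def algebra_simps sum_subtractf)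

lemma pair_mult_left: "pair (\<lambda>c. \<phi> c * a) f = pair \<phi> f * a"
  by (simp add: pair_def sum_distrib_right mult.assoc)

lemma pair_cong: "(\<And>c. f c \<noteq> 0 \<Longrightarrow> \<phi> c = \<psi> c) \<Longrightarrow> pair \<phi> f = pair \<psi> f"
  by (simp add: pair_def)

text \<open>The right-hand side is \<open>b\<close> times the l1-norm of \<open>f\<close>.\<close>

lemma pair_bound:
  assumes "\<And>c. f c \<noteq> 0 \<Longrightarrow> \<bar>\<phi> c\<bar> \<le> b"
  shows "\<bar>pair \<phi> f\<bar> \<le> pair (\<lambda>_. b) (\<lambda>c. \<bar>f c\<bar>)"
proof -
  have "\<bar>pair \<phi> f\<bar> \<le> (\<Sum>c\<in>{c. f c \<noteq> 0}. \<bar>f c * \<phi> c\<bar>)"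
    unfolding pair_def by (rule sum_abs)
  also have "\<dots> \<le> (\<Sum>c\<in>{c. f c \<noteq> 0}. \<bar>f c\<bar> * b)"
    using assms by (intro sum_mono) (auto simp: abs_mult intro: mult_left_mono)
  finally show ?thesis by (simp add: pair_def)
qed

definition basis :: "'c \<Rightarrow> 'c \<Rightarrow> int" where
  "basis c = (\<lambda>x. if x = c then 1 else 0)"

lemma pair_basis: "pair \<phi> (basis c) = \<phi> c"
proof -
  have "{x. basis c x \<noteq> 0} = {c}" by (auto simp: basis_def)
  then show ?thesis by (simp add: pair_def basis_def)
qed

lemma pair_cobd:
  assumes "\<And>ys. set ys \<subseteq> set xs \<Longrightarrow> Suc (length ys) = length xs \<Longrightarrow> finite {c. F ys c \<noteq> 0}"
  shows "finite {c. cobd (\<lambda>ys. F ys c) xs \<noteq> 0} \<and>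
    pair \<phi> (\<lambda>c. cobd (\<lambda>ys. F ys c) xs) = cobd (\<lambda>ys. pair \<phi> (F ys)) xs"
  using assms
proof (induction xs arbitrary: F)
  case (Cons x xs)
  have IH: "finite {c. cobd (\<lambda>ys. F (x # ys) c) xs \<noteq> 0} \<and>
    pair \<phi> (\<lambda>c. cobd (\<lambda>ys. F (x # ys) c) xs) = cobd (\<lambda>ys. pair \<phi> (F (x # ys))) xs"
    by (rule Cons.IH, rule Cons.prems) auto
  have fin: "finite {c. F xs c \<noteq> 0}"
    by (rule Cons.prems) auto
  have "finite {c. F xs c - cobd (\<lambda>ys. F (x # ys) c) xs \<noteq> 0}"
    by (rule finite_subset[OF _ finite_UnI[OF fin conjunct1[OF IH]]]) auto
  then show ?case using IH fin by (simp add: pair_diff)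
qed auto

lemma aug_pair: "aug eps f = pair (\<lambda>c. eps (snd c)) f"
  by (simp add: aug_def pair_def)

lemma bdry_pair: "bdry G b f x = pair (\<lambda>c. translate G (fst c) (b (snd c)) x) f"
  by (simp add: bdry_def pair_def)

text \<open>\<open>bdry G b\<close> is the equivariant map sending the generator \<open>j\<close> to
  \<open>b j\<close>, and \<open>ccob G b\<close> is its transpose, see \<open>pair_bdry\<close>.
  Both are used for the homotopy as well as for the boundary maps.\<close>

definition ccob :: "'g monoid \<Rightarrow> (nat \<Rightarrow> 'g \<times> nat \<Rightarrow> int) \<Rightarrow> ('g \<times> nat \<Rightarrow> int) \<Rightarrow> 'g \<times> nat \<Rightarrow> int" where
  "ccob G b \<phi> c = pair (\<lambda>e. \<phi> (fst c \<otimes>\<^bsub>G\<^esub> fst e, snd e)) (b (snd c))"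

lemma coboundary_ccob: "coboundary G d n \<phi> = ccob G (d (Suc n)) \<phi>"
  by (auto simp: coboundary_def ccob_def pair_def)

lemma ccob_diff: "ccob G b (\<lambda>c. \<phi> c - \<psi> c) c = ccob G b \<phi> c - ccob G b \<psi> c"
  by (simp add: ccob_def pair_diff_left)

lemma chainsI:
  "finite {c. f c \<noteq> 0} \<Longrightarrow> (\<And>c. f c \<noteq> 0 \<Longrightarrow> fst c \<in> carrier G \<and> snd c < r) \<Longrightarrow> f \<in> chains G r"
  by (auto simp: chains_def)

lemma chains_finite: "f \<in> chains G r \<Longrightarrow> finite {c. f c \<noteq> 0}"
  by (simp add: chains_def)

lemma chains_cell: "f \<in> chains G r \<Longrightarrow> f c \<noteq> 0 \<Longrightarrow> fst c \<in> carrier G \<and> snd c < r"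
  by (cases c) (auto simp: chains_def)

lemma zero_chain [simp]: "(\<lambda>_. 0) \<in> chains G r"
  by (simp add: chains_def)

lemma chains_diff:
  assumes "f \<in> chains G r" "h \<in> chains G r"
  shows "(\<lambda>c. f c - h c) \<in> chains G r"
proof (rule chainsI)
  show "finite {c. f c - h c \<noteq> 0}"
    by (rule finite_subset[OF _ finite_UnI[OF chains_finite[OF assms(1)] chains_finite[OF assms(2)]]]) auto
  show "fst c \<in> carrier G \<and> snd c < r" if "f c - h c \<noteq> 0" for c
    using that chains_cell[OF assms(1), of c] chains_cell[OF assms(2), of c] by (cases "f c = 0") auto
qed

lemma chains_lincomb:
  assumes "f \<in> chains G r" "h \<in> chains G r"
  shows "(\<lambda>c. a * f c + h c) \<in> chains G r"
proof (rule chainsI)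
  show "finite {c. a * f c + h c \<noteq> 0}"
    by (rule finite_subset[OF _ finite_UnI[OF chains_finite[OF assms(1)] chains_finite[OF assms(2)]]]) auto
  show "fst c \<in> carrier G \<and> snd c < r" if "a * f c + h c \<noteq> 0" for c
    using that chains_cell[OF assms(1), of c] chains_cell[OF assms(2), of c] by (cases "f c = 0") auto
qed

lemma chains_sum:
  assumes "finite I" "\<And>i. i \<in> I \<Longrightarrow> F i \<in> chains G r"
  shows "(\<lambda>c. \<Sum>i\<in>I. a i * F i c) \<in> chains G r"
  using assms by (induction I) (simp_all add: chains_lincomb)

lemma chains_sum_list:
  assumes "\<And>w l. (w, l) \<in> set ws \<Longrightarrow> F l \<in> chains G r"
  shows "(\<lambda>c. \<Sum>(w, l)\<leftarrow>ws. w * F l c) \<in> chains G r"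
    and "pair \<phi> (\<lambda>c. \<Sum>(w, l)\<leftarrow>ws. w * F l c) = (\<Sum>(w, l)\<leftarrow>ws. w * pair \<phi> (F l))"
proof -
  have "(\<lambda>c. \<Sum>(w, l)\<leftarrow>ws. w * F l c) \<in> chains G r \<and>
    pair \<phi> (\<lambda>c. \<Sum>(w, l)\<leftarrow>ws. w * F l c) = (\<Sum>(w, l)\<leftarrow>ws. w * pair \<phi> (F l))"
    using assms
  proof (induction ws)
    case (Cons a ws)
    obtain w l where a: "a = (w, l)" by fastforce
    have F: "F l \<in> chains G r" using Cons.prems[of w l] a by simp
    have IH: "(\<lambda>c. \<Sum>(w, l)\<leftarrow>ws. w * F l c) \<in> chains G r"
      "pair \<phi> (\<lambda>c. \<Sum>(w, l)\<leftarrow>ws. w * F l c) = (\<Sum>(w, l)\<leftarrow>ws. w * pair \<phi> (F l))"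
      using Cons by auto
    show ?case
      using chains_lincomb[OF F IH(1)] pair_lincomb[OF chains_finite[OF F] chains_finite[OF IH(1)]] IH(2)
      by (simp add: a)
  qed auto
  then show "(\<lambda>c. \<Sum>(w, l)\<leftarrow>ws. w * F l c) \<in> chains G r"
    and "pair \<phi> (\<lambda>c. \<Sum>(w, l)\<leftarrow>ws. w * F l c) = (\<Sum>(w, l)\<leftarrow>ws. w * pair \<phi> (F l))"
    by auto
qed

lemma chains_cobd:
  assumes "\<And>ys. set ys \<subseteq> set xs \<Longrightarrow> Suc (length ys) = length xs \<Longrightarrow> F ys \<in> chains G r"
  shows "(\<lambda>c. cobd (\<lambda>ys. F ys c) xs) \<in> chains G r"
  using assms
proof (induction xs arbitrary: F)
  case (Cons x xs)
  have "(\<lambda>c. cobd (\<lambda>ys. F (x # ys) c) xs) \<in> chains G r"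
    by (rule Cons.IH, rule Cons.prems) auto
  moreover have "F xs \<in> chains G r" by (rule Cons.prems) auto
  ultimately show ?case by (simp add: chains_diff)
qed auto

lemma translate_zero [simp]: "translate G g (\<lambda>_. 0) = (\<lambda>_. 0)"
  by (auto simp: translate_def)

lemma translate_diff: "translate G g (\<lambda>c. f c - h c) = (\<lambda>c. translate G g f c - translate G g h c)"
  by (auto simp: translate_def)

lemma translate_cobd:
  "translate G g (\<lambda>c. cobd (\<lambda>ys. F ys c) xs) c = cobd (\<lambda>ys. translate G g (F ys) c) xs"
  by (cases c) (auto simp: translate_def)

lemma bdry_zero [simp]: "bdry G b (\<lambda>_. 0) = (\<lambda>_. 0)"
  by (simp add: bdry_pair fun_eq_iff)

lemma bdry_diff:
  assumes "f \<in> chains G r" "h \<in> chains G r"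
  shows "bdry G b (\<lambda>c. f c - h c) = (\<lambda>x. bdry G b f x - bdry G b h x)"
  using assms by (simp add: bdry_pair fun_eq_iff pair_diff chains_finite)

lemma bdry_diff_left: "bdry G (\<lambda>j c. b j c - b' j c) f x = bdry G b f x - bdry G b' f x"
  by (simp add: bdry_pair translate_diff pair_diff_left)

lemma bdry_cong:
  assumes "f \<in> chains G r" "\<And>j. j < r \<Longrightarrow> b j = b' j"
  shows "bdry G b f = bdry G b' f"
  unfolding fun_eq_iff bdry_pair
  using chains_cell[OF assms(1)] assms(2) by (intro allI pair_cong) simp

locale cellular_group = group G for G :: "'g monoid" (structure)
begin

lemma translate_chains:
  assumes "g \<in> carrier G" "f \<in> chains G r"
  shows "translate G g f \<in> chains G r"
proof (rule chainsI)
  show "finite {c. translate G g f c \<noteq> 0}"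
  proof (rule finite_subset)
    show "{c. translate G g f c \<noteq> 0} \<subseteq> (\<lambda>c. (g \<otimes> fst c, snd c)) ` {c. f c \<noteq> 0}"
    proof
      fix c assume "c \<in> {c. translate G g f c \<noteq> 0}"
      then have "f (inv g \<otimes> fst c, snd c) \<noteq> 0" "fst c \<in> carrier G"
        by (auto simp: translate_def split: if_splits prod.splits)
      then show "c \<in> (\<lambda>c. (g \<otimes> fst c, snd c)) ` {c. f c \<noteq> 0}"
        using assms(1) inv_mult_cancel by (intro image_eqI[of _ _ "(inv g \<otimes> fst c, snd c)"]) auto
    qed
    show "finite ((\<lambda>c. (g \<otimes> fst c, snd c)) ` {c. f c \<noteq> 0})"
      using assms chains_finite by blast
  qed
  show "fst c \<in> carrier G \<and> snd c < r" if "translate G g f c \<noteq> 0" for c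
    using that chains_cell[OF assms(2)] by (fastforce simp: translate_def split: if_splits prod.splits)
qed

lemma pair_translate:
  assumes "g \<in> carrier G" "f \<in> chains G r"
  shows "pair \<phi> (translate G g f) = pair (\<lambda>c. \<phi> (g \<otimes> fst c, snd c)) f"
  unfolding pair_def
proof (rule sum.reindex_bij_witness[of _ "\<lambda>c. (g \<otimes> fst c, snd c)" "\<lambda>c. (inv g \<otimes> fst c, snd c)"])
qed (use assms chains_cell[OF assms(2)] inv_mult_cancel in
      \<open>force simp: translate_def split: if_splits\<close>)+

lemma translate_translate:
  "g \<in> carrier G \<Longrightarrow> h \<in> carrier G \<Longrightarrow> translate G g (translate G h f) = translate G (g \<otimes> h) f"
  by (auto simp: translate_def fun_eq_iff inv_mult_group m_assoc)

lemma translate_one: "f \<in> chains G r \<Longrightarrow> translate G \<one> f = f"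
  using chains_cell by (fastforce simp: translate_def fun_eq_iff)

lemma bdry_chains:
  assumes "f \<in> chains G r" "\<And>j. j < r \<Longrightarrow> b j \<in> chains G s"
  shows "bdry G b f \<in> chains G s"
  unfolding bdry_def
  using assms chains_cell[OF assms(1)] chains_finite[OF assms(1)]
  by (intro chains_sum) (auto intro!: translate_chains)

lemma pair_bdry:
  assumes f: "f \<in> chains G r" and b: "\<And>j. j < r \<Longrightarrow> b j \<in> chains G s"
  shows "pair \<phi> (bdry G b f) = pair (ccob G b \<phi>) f"
proof -
  have "pair \<phi> (bdry G b f) = (\<Sum>c\<in>{c. f c \<noteq> 0}. f c * pair \<phi> (translate G (fst c) (b (snd c))))"
    unfolding bdry_def
    using chains_finite[OF f] chains_cell[OF f] chains_finite[OF translate_chains[OF _ b]]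
    by (intro pair_sum(2)) auto
  also have "\<dots> = pair (ccob G b \<phi>) f"
    unfolding pair_def[of _ f] ccob_def
    using chains_cell[OF f] b by (intro sum.cong refl arg_cong2[where f="(*)"] pair_translate[where r=s]) auto
  finally show ?thesis .
qed

lemma bdry_translate:
  assumes "g \<in> carrier G" "f \<in> chains G r"
  shows "bdry G b (translate G g f) = translate G g (bdry G b f)"
proof (rule ext)
  fix x
  have "bdry G b (translate G g f) x =
      pair (\<lambda>c. translate G g (translate G (fst c) (b (snd c))) x) f"
    unfolding bdry_pair pair_translate[OF assms]
    using chains_cell[OF assms(2)] assms(1) by (intro pair_cong) (simp add: translate_translate)
  also have "\<dots> = translate G g (bdry G b f) x"
    by (cases x) (auto simp: translate_def[of G g] bdry_pair)
  finally show "bdry G b (translate G g f) x = translate G g (bdry G b f) x" .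
qed

text \<open>Equivariant maps are determined by the images of the generators, so a composite is
  obtained by applying the outer map to the values of the inner one.\<close>

lemma bdry_bdry:
  assumes f: "f \<in> chains G r" and b': "\<And>j. j < r \<Longrightarrow> b' j \<in> chains G s"
  shows "bdry G b (bdry G b' f) = bdry G (\<lambda>j. bdry G b (b' j)) f"
proof (rule ext)
  fix x
  have "bdry G b (bdry G b' f) x = pair (ccob G b' (\<lambda>c. translate G (fst c) (b (snd c)) x)) f"
    unfolding bdry_pair[of G b] by (rule pair_bdry[OF assms])
  also have "\<dots> = bdry G (\<lambda>j. bdry G b (b' j)) f x"
    unfolding bdry_pair[of G _ f]
  proof (rule pair_cong)
    fix c assume "f c \<noteq> 0"
    then have c: "fst c \<in> carrier G" "b' (snd c) \<in> chains G s" using chains_cell[OF f] b' by auto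
    show "ccob G b' (\<lambda>c. translate G (fst c) (b (snd c)) x) c = translate G (fst c) (bdry G b (b' (snd c))) x"
      unfolding bdry_translate[OF c, symmetric] bdry_pair pair_translate[OF c]
      by (simp add: ccob_def)
  qed
  finally show "bdry G b (bdry G b' f) x = bdry G (\<lambda>j. bdry G b (b' j)) f x" .
qed

lemma basis_chain: "g \<in> carrier G \<Longrightarrow> j < r \<Longrightarrow> basis (g, j) \<in> chains G r"
  by (rule chainsI) (auto simp: basis_def split: if_splits)

lemma translate_basis: "g \<in> carrier G \<Longrightarrow> translate G g (basis (\<one>, j)) = basis (g, j)"
  by (auto simp: translate_def basis_def fun_eq_iff) (metis inv_closed inv_equality inv_inv)

lemma bdry_basis_one: "b j \<in> chains G r \<Longrightarrow> bdry G b (basis (\<one>, j)) = b j"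
  by (simp add: fun_eq_iff bdry_pair pair_basis translate_one)

lemma bdry_identity:
  assumes "f \<in> chains G r"
  shows "bdry G (\<lambda>j. basis (\<one>, j)) f = f"
proof (rule ext)
  fix x
  have "bdry G (\<lambda>j. basis (\<one>, j)) f x = pair (basis x) f"
    unfolding bdry_pair
    using chains_cell[OF assms] by (intro pair_cong) (auto simp: translate_basis, auto simp: basis_def)
  also have "\<dots> = f x"
    using chains_finite[OF assms] by (cases "f x = 0") (auto simp: pair_def basis_def if_distrib cong: if_cong)
  finally show "bdry G (\<lambda>j. basis (\<one>, j)) f x = f x" .
qed

end

section \<open>Comparison with the bar complex\<close>

locale resolution = cellular_group G for G :: "'g monoid" (structure) +
  fixes k :: "nat \<Rightarrow> nat" and d :: "nat \<Rightarrow> nat \<Rightarrow> ('g \<times> nat \<Rightarrow> int)" and eps :: "nat \<Rightarrow> int"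
  assumes res: "free_resolution_fin_type G k d eps"
begin

lemma d_chain: "j < k (Suc m) \<Longrightarrow> d (Suc m) j \<in> chains G (k m)"
  using res unfolding free_resolution_fin_type_def by (metis diff_Suc_1 le_add1 plus_1_eq_Suc)

text \<open>In degree 0 the augmentation takes the place of the boundary, which makes exactness a
  single statement for all degrees.\<close>

definition cycle :: "nat \<Rightarrow> ('g \<times> nat \<Rightarrow> int) \<Rightarrow> bool" where
  "cycle m f \<longleftrightarrow> f \<in> chains G (k m) \<and>
     (if m = 0 then aug eps f = 0 else bdry G (d m) f = (\<lambda>_. 0))"

lemma exact: "cycle m f \<Longrightarrow> \<exists>c\<in>chains G (k (Suc m)). bdry G (d (Suc m)) c = f"
  using res unfolding free_resolution_fin_type_def cycle_def by (cases m) auto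

lemma bdry_cycle:
  assumes "c \<in> chains G (k (Suc m))"
  shows "cycle m (bdry G (d (Suc m)) c)"
proof -
  have c: "bdry G (d (Suc m)) c \<in> chains G (k m)"
    using bdry_chains[OF assms] d_chain by blast
  show ?thesis
  proof (cases m)
    case 0
    then show ?thesis
      using res assms c unfolding free_resolution_fin_type_def cycle_def by auto
  next
    case (Suc l)
    then have "\<forall>f\<in>chains G (k m).
        bdry G (d m) f = (\<lambda>_. 0) \<longleftrightarrow> (\<exists>c\<in>chains G (k (Suc m)). bdry G (d (Suc m)) c = f)"
      using res unfolding free_resolution_fin_type_def by simp
    then show ?thesis using assms c Suc by (auto simp: cycle_def)
  qed
qed

lemma d_cycle:
  assumes "j < k (Suc m)"
  shows "cycle m (d (Suc m) j)"
  using bdry_cycle[of "basis (\<one>, j)" m] basis_chain[of \<one> j] bdry_basis_one[where b="d (Suc m)", OF d_chain[OF assms]] assms by simp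

text \<open>Sending \<open>0\<close> to \<open>0\<close> is what makes the comparison map below vanish on degenerate simplices.\<close>

definition fill :: "nat \<Rightarrow> ('g \<times> nat \<Rightarrow> int) \<Rightarrow> ('g \<times> nat \<Rightarrow> int)" where
  "fill m f = (if f = (\<lambda>_. 0) then (\<lambda>_. 0)
     else SOME c. c \<in> chains G (k (Suc m)) \<and> bdry G (d (Suc m)) c = f)"

lemma fill_zero [simp]: "fill m (\<lambda>_. 0) = (\<lambda>_. 0)"
  by (simp add: fill_def)

lemma fill:
  assumes "cycle m f"
  shows "fill m f \<in> chains G (k (Suc m))" "bdry G (d (Suc m)) (fill m f) = f"
proof -
  have "\<exists>c. c \<in> chains G (k (Suc m)) \<and> bdry G (d (Suc m)) c = f"
    using exact[OF assms] by blast
  from someI_ex[OF this]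
  show "fill m f \<in> chains G (k (Suc m))" "bdry G (d (Suc m)) (fill m f) = f"
    by (auto simp: fill_def)
qed

lemma cycle_translate:
  assumes "g \<in> carrier G" "cycle m f"
  shows "cycle m (translate G g f)"
proof -
  have f: "f \<in> chains G (k m)" using assms(2) by (simp add: cycle_def)
  show ?thesis
    using assms(2) translate_chains[OF assms(1) f] bdry_translate[OF assms(1) f]
    by (auto simp: cycle_def aug_pair pair_translate[OF assms(1) f])
qed

section \<open>The chain map from the bar complex to the resolution\<close>

definition vertex :: "'g \<times> nat \<Rightarrow> int" where
  "vertex = (SOME f. f \<in> chains G (k 0) \<and> aug eps f = 1)"

lemma vertex: "vertex \<in> chains G (k 0)" "aug eps vertex = 1"
proof -
  have "\<exists>f. f \<in> chains G (k 0) \<and> aug eps f = 1"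
    using res by (auto simp: free_resolution_fin_type_def)
  from someI_ex[OF this] show "vertex \<in> chains G (k 0)" "aug eps vertex = 1"
    by (auto simp: vertex_def)
qed

text \<open>Moving the first vertex to \<open>\<one>\<close> before filling makes \<open>bar_chain\<close> equivariant although \<open>fill\<close> is not.\<close>

primrec bar_chain :: "nat \<Rightarrow> 'g list \<Rightarrow> 'g \<times> nat \<Rightarrow> int" where
  "bar_chain 0 = (\<lambda>xs. if length xs = 1 then translate G (hd xs) vertex else (\<lambda>_. 0))"
| "bar_chain (Suc m) = (\<lambda>xs. translate G (hd xs) (fill m (translate G (inv hd xs)
      (\<lambda>c. cobd (\<lambda>ys. bar_chain m ys c) xs))))"

lemma bar_chain_normalized: "normalized (\<lambda>xs. bar_chain m xs c)"
proof (induction m arbitrary: c)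
  case 0
  have "length xs = 1 \<Longrightarrow> distinct_adj xs" for xs :: "'g list"
    by (cases xs) auto
  then show ?case by (auto simp: normalized_def)
next
  case (Suc m)
  have "(\<lambda>c. cobd (\<lambda>ys. bar_chain m ys c) xs) = (\<lambda>_. 0)" if "\<not> distinct_adj xs" for xs
    using cobd_normalized[OF Suc.IH] that by (auto simp: normalized_def)
  then show ?case by (auto simp: normalized_def)
qed

text \<open>\<open>fill\<close> inverts the boundary only on cycles, so membership and the boundary
  formula are proved together: the formula one degree lower shows that the argument of
  \<open>fill\<close> is a cycle.\<close>

lemma bar_chain_spec:
  "set xs \<subseteq> carrier G \<Longrightarrow> length xs = Suc m \<Longrightarrow>
    bar_chain m xs \<in> chains G (k m) \<and>
    (if m = 0 then aug eps (bar_chain m xs) = 1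
     else bdry G (d m) (bar_chain m xs) = (\<lambda>c. cobd (\<lambda>ys. bar_chain (m - 1) ys c) xs))"
proof (induction m arbitrary: xs)
  case 0
  then have "hd xs \<in> carrier G" by (cases xs) auto
  then show ?case
    using 0 vertex translate_chains by (simp add: aug_pair pair_translate[OF _ vertex(1)])
next
  case (Suc m)
  let ?f = "\<lambda>c. cobd (\<lambda>ys. bar_chain m ys c) xs"
  have x: "hd xs \<in> carrier G" "xs \<noteq> []" using Suc.prems by (cases xs; auto)+
  have sub: "bar_chain m ys \<in> chains G (k m)" if "set ys \<subseteq> set xs" "Suc (length ys) = length xs" for ys
    using Suc.IH[of ys] that Suc.prems by auto
  have fch: "?f \<in> chains G (k m)" using chains_cobd sub by blast
  have pf: "pair \<phi> ?f = cobd (\<lambda>ys. pair \<phi> (bar_chain m ys)) xs" for \<phi>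
    using pair_cobd[of xs "bar_chain m" \<phi>] sub chains_finite by blast
  have cyc: "cycle m ?f"
  proof (cases m)
    case 0
    have "aug eps ?f = cobd (\<lambda>ys. aug eps (bar_chain m ys)) xs" unfolding aug_pair by (rule pf)
    also have "\<dots> = cobd (\<lambda>_. 1) xs"
      using Suc.IH Suc.prems 0 by (intro cobd_cong) auto
    also have "\<dots> = 0"
      using Suc.prems 0 by (cases xs; cases "tl xs") auto
    finally show ?thesis using fch 0 by (simp add: cycle_def)
  next
    case (Suc l)
    have "bdry G (d m) ?f z = 0" for z
    proof -
      have "bdry G (d m) ?f z = cobd (\<lambda>ys. bdry G (d m) (bar_chain m ys) z) xs" unfolding bdry_pair by (rule pf)
      also have "\<dots> = cobd (cobd (\<lambda>ys. bar_chain l ys z)) xs"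
        using Suc.IH Suc.prems Suc by (intro cobd_cong) (auto dest!: subset_trans)
      finally show ?thesis by (simp add: cobd_cobd)
    qed
    then show ?thesis using fch Suc by (auto simp: cycle_def)
  qed
  have c': "cycle m (translate G (inv hd xs) ?f)" using cycle_translate[OF _ cyc] x by simp
  note F = fill[OF c']
  have "bar_chain (Suc m) xs \<in> chains G (k (Suc m))" using translate_chains[OF x(1) F(1)] by simp
  moreover have "bdry G (d (Suc m)) (bar_chain (Suc m) xs) = ?f"
    using bdry_translate[OF x(1) F(1)] F(2) x translate_one[OF fch] by (simp add: translate_translate)
  ultimately show ?case by simp
qed

text \<open>After moving the first vertex to \<open>\<one>\<close>, a simplex and its translate lead
  to the same argument of \<open>fill\<close>, because
  \<open>inv (g \<otimes> x) \<otimes> g = inv x\<close>.\<close>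

lemma bar_chain_equivariant:
  "g \<in> carrier G \<Longrightarrow> set xs \<subseteq> carrier G \<Longrightarrow> length xs = Suc m \<Longrightarrow>
    bar_chain m (map ((\<otimes>) g) xs) = translate G g (bar_chain m xs)"
proof (induction m arbitrary: xs)
  case 0
  then have "hd xs \<in> carrier G" "hd (map ((\<otimes>) g) xs) = g \<otimes> hd xs" by (cases xs; auto)+
  then show ?case using 0 by (simp add: translate_translate)
next
  case (Suc m)
  have x: "hd xs \<in> carrier G" "hd (map ((\<otimes>) g) xs) = g \<otimes> hd xs" using Suc.prems by (cases xs; auto)+
  let ?f = "\<lambda>c. cobd (\<lambda>ys. bar_chain m ys c) xs"
  have "cobd (\<lambda>ys. bar_chain m ys c) (map ((\<otimes>) g) xs) = translate G g ?f c" for c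
  proof -
    have "cobd (\<lambda>ys. bar_chain m ys c) (map ((\<otimes>) g) xs) = cobd (\<lambda>ys. bar_chain m (map ((\<otimes>) g) ys) c) xs"
      using cobd_map[of "\<lambda>ys. bar_chain m ys c" "(\<otimes>) g" xs] by simp
    also have "\<dots> = cobd (\<lambda>ys. translate G g (bar_chain m ys) c) xs"
      using Suc by (intro cobd_cong) (auto simp: subset_iff)
    finally show ?thesis by (simp add: translate_cobd)
  qed
  then have "(\<lambda>c. cobd (\<lambda>ys. bar_chain m ys c) (map ((\<otimes>) g) xs)) = translate G g ?f" by blast
  moreover have "inv (g \<otimes> hd xs) \<otimes> g = inv hd xs"
    using x Suc.prems(1) by (simp add: inv_mult_group m_assoc)
  ultimately show ?case
    using x Suc.prems(1) by (simp add: translate_translate)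
qed

text \<open>Pullback of bar cochains along the chain map that sends a cell \<open>(g, j)\<close> to the cone with apex \<open>g\<close>
  over the image of its boundary.\<close>

primrec cell_eval :: "nat \<Rightarrow> ('g list \<Rightarrow> int) \<Rightarrow> 'g \<times> nat \<Rightarrow> int" where
  "cell_eval 0 = (\<lambda>P c. eps (snd c) * P [fst c])"
| "cell_eval (Suc m) = (\<lambda>P c. ccob G (d (Suc m)) (cell_eval m (\<lambda>ys. P (fst c # ys))) c)"

lemma cell_eval_diff: "cell_eval m (\<lambda>ys. P ys - Q ys) c = cell_eval m P c - cell_eval m Q c"
proof (induction m arbitrary: P Q c)
  case (Suc m)
  have "cell_eval m (\<lambda>ys. P (fst c # ys) - Q (fst c # ys)) = 
    (\<lambda>e. cell_eval m (\<lambda>ys. P (fst c # ys)) e - cell_eval m (\<lambda>ys. Q (fst c # ys)) e)"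
    using Suc by (intro ext)
  then show ?case by (simp add: ccob_diff)
qed (simp add: algebra_simps)

lemma ccob_translate:
  assumes "fst c \<in> carrier G" "b (snd c) \<in> chains G r"
  shows "ccob G b \<phi> c = pair \<phi> (translate G (fst c) (b (snd c)))"
  using pair_translate[OF assms] by (simp add: ccob_def)

lemma ccob_ccob:
  assumes "fst c \<in> carrier G" "snd c < k (Suc (Suc m))"
  shows "ccob G (d (Suc (Suc m))) (ccob G (d (Suc m)) \<phi>) c = 0"
proof -
  have ch: "d (Suc (Suc m)) (snd c) \<in> chains G (k (Suc m))" using d_chain assms by blast
  have "bdry G (d (Suc m)) (d (Suc (Suc m)) (snd c)) = (\<lambda>_. 0)"
    using d_cycle[OF assms(2)] by (simp add: cycle_def)
  then have "pair \<phi> (bdry G (d (Suc m)) (translate G (fst c) (d (Suc (Suc m)) (snd c)))) = 0"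
    by (simp add: bdry_translate[OF assms(1) ch])
  moreover have "pair \<phi> (bdry G (d (Suc m)) (translate G (fst c) (d (Suc (Suc m)) (snd c)))) =
      pair (ccob G (d (Suc m)) \<phi>) (translate G (fst c) (d (Suc (Suc m)) (snd c)))"
    using d_chain by (intro pair_bdry[OF translate_chains[OF assms(1) ch]])
  ultimately show ?thesis
    using ccob_translate[where b="d (Suc (Suc m))", OF assms(1) ch] by simp
qed

lemma ccob_cong:
  assumes "fst c \<in> carrier G" "b (snd c) \<in> chains G r"
    and "\<And>e. fst e \<in> carrier G \<Longrightarrow> snd e < r \<Longrightarrow> \<phi> e = \<psi> e"
  shows "ccob G b \<phi> c = ccob G b \<psi> c"
  unfolding ccob_def using chains_cell[OF assms(2)] assms(1,3) by (intro pair_cong) auto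

text \<open>Omitting the apex of the cone gives the right-hand side. The faces through the apex give
  a pullback along two consecutive boundary maps, which is 0; in the lowest degree the reason is
  that \<open>eps\<close> vanishes on boundaries.\<close>

lemma cell_eval_cobd:
  assumes "fst c \<in> carrier G" "snd c < k (Suc m)"
  shows "cell_eval (Suc m) (cobd P) c = ccob G (d (Suc m)) (cell_eval m P) c"
  using assms
proof (induction m arbitrary: P c)
  case 0
  have "ccob G (d 1) (\<lambda>e. eps (snd e) * P [fst c]) c = pair (\<lambda>e. eps (snd e)) (d 1 (snd c)) * P [fst c]"
    by (simp add: ccob_def pair_mult_left)
  also have "\<dots> = 0" using d_cycle[OF 0(2)] by (simp add: cycle_def aug_pair)
  finally show ?case
    using ccob_diff[of G "d 1" "\<lambda>e. eps (snd e) * P [fst e]" "\<lambda>e. eps (snd e) * P [fst c]" c]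
    by (simp add: algebra_simps)
next
  case (Suc m)
  have ch: "d (Suc (Suc m)) (snd c) \<in> chains G (k (Suc m))" using d_chain Suc.prems by blast
  let ?P = "\<lambda>ys. P (fst c # ys)"
  have "cell_eval (Suc (Suc m)) (cobd P) c =
      ccob G (d (Suc (Suc m))) (\<lambda>e. cell_eval (Suc m) P e - cell_eval (Suc m) (cobd ?P) e) c"
    by (simp del: cell_eval.simps add: cell_eval.simps(2)[of "Suc m"] cell_eval_diff[symmetric])
  also have "\<dots> = ccob G (d (Suc (Suc m))) (cell_eval (Suc m) P) c
      - ccob G (d (Suc (Suc m))) (cell_eval (Suc m) (cobd ?P)) c"
    by (rule ccob_diff)
  also have "ccob G (d (Suc (Suc m))) (cell_eval (Suc m) (cobd ?P)) c =
      ccob G (d (Suc (Suc m))) (ccob G (d (Suc m)) (cell_eval m ?P)) c"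
    using Suc.IH by (intro ccob_cong[where b="d (Suc (Suc m))", OF Suc.prems(1) ch]) blast
  also have "\<dots> = 0" using ccob_ccob Suc.prems by blast
  finally show ?case by simp
qed

text \<open>The combination \<open>ws\<close> depends on \<open>j\<close> alone, and
  \<open>g\<close> merely translates it. This turns bounds for each diameter into bounds on cells,
  and lets \<open>pair\<close> be interchanged with \<open>cell_eval\<close>.\<close>

lemma cell_eval_representation:
  "j < k m \<Longrightarrow> \<exists>ws :: (int \<times> 'g list) list.
     (\<forall>(w, l)\<in>set ws. set l \<subseteq> carrier G \<and> length l = Suc m) \<and>
     (\<forall>P. \<forall>g\<in>carrier G. cell_eval m P (g, j) = (\<Sum>(w, l)\<leftarrow>ws. w * P (map ((\<otimes>) g) l)))"
proof (induction m arbitrary: j)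
  case 0
  show ?case by (intro exI[of _ "[(eps j, [\<one>])]"]) auto
next
  case (Suc m)
  then have "\<forall>i. \<exists>ws :: (int \<times> 'g list) list. i < k m \<longrightarrow>
     (\<forall>(w, l)\<in>set ws. set l \<subseteq> carrier G \<and> length l = Suc m) \<and>
     (\<forall>P. \<forall>g\<in>carrier G. cell_eval m P (g, i) = (\<Sum>(w, l)\<leftarrow>ws. w * P (map ((\<otimes>) g) l)))"
    by blast
  then obtain W :: "nat \<Rightarrow> (int \<times> 'g list) list" where
    W1: "\<And>i w l. i < k m \<Longrightarrow> (w, l) \<in> set (W i) \<Longrightarrow> set l \<subseteq> carrier G \<and> length l = Suc m" and
    W2: "\<And>i P g. i < k m \<Longrightarrow> g \<in> carrier G \<Longrightarrow>
      cell_eval m P (g, i) = (\<Sum>(w, l)\<leftarrow>W i. w * P (map ((\<otimes>) g) l))"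
    by (fastforce dest!: choice)
  let ?d = "d (Suc m) j"
  have ch: "?d \<in> chains G (k m)" using d_chain Suc.prems by blast
  obtain es where es: "set es = {e. ?d e \<noteq> 0}" "distinct es"
    using finite_distinct_list[OF chains_finite[OF ch]] by blast
  have cell: "fst e \<in> carrier G" "snd e < k m" if "e \<in> set es" for e
    using that es chains_cell[OF ch] by auto
  \<comment> \<open>The cone over the boundary cell \<open>e\<close>, with apex
    \<open>\<one>\<close>; translation by \<open>g\<close> later moves the apex to \<open>g\<close>
    and the cell to \<open>g \<otimes> fst e\<close>.\<close>
  define V where "V e = map (\<lambda>(w, l). (?d e * w, \<one> # map ((\<otimes>) (fst e)) l)) (W (snd e))" for e
  have V: "(\<Sum>(w, l)\<leftarrow>V e. w * P (map ((\<otimes>) g) l)) = ?d e * cell_eval m (\<lambda>ys. P (g # ys)) (g \<otimes> fst e, snd e)"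
    if e: "e \<in> set es" and g: "g \<in> carrier G" for P g e
  proof -
    have "(\<Sum>(w, l)\<leftarrow>V e. w * P (map ((\<otimes>) g) l)) =
      (\<Sum>(w, l)\<leftarrow>W (snd e). ?d e * (w * P (g # map ((\<otimes>) (g \<otimes> fst e)) l)))"
      unfolding V_def map_map
    proof (rule arg_cong[of _ _ sum_list], rule map_cong[OF refl])
      fix a assume a: "a \<in> set (W (snd e))"
      obtain w l where wl: "a = (w, l)" by fastforce
      have "map ((\<otimes>) g \<circ> (\<otimes>) (fst e)) l = map ((\<otimes>) (g \<otimes> fst e)) l"
        using W1[of "snd e" w l] cell[OF e] g a wl by (auto simp: m_assoc)
      then show "((\<lambda>(w, l). w * P (map ((\<otimes>) g) l)) \<circ> (\<lambda>(w, l). (?d e * w, \<one> # map ((\<otimes>) (fst e)) l))) a =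
        (case a of (w, l) \<Rightarrow> ?d e * (w * P (g # map ((\<otimes>) (g \<otimes> fst e)) l)))"
        using g by (simp add: wl del: map_eq_conv)
    qed
    also have "\<dots> = ?d e * (\<Sum>(w, l)\<leftarrow>W (snd e). w * P (g # map ((\<otimes>) (g \<otimes> fst e)) l))"
      by (simp add: sum_list_const_mult[symmetric] case_prod_unfold)
    finally show ?thesis using W2[of "snd e" "g \<otimes> fst e"] cell[OF e] g by simp
  qed
  have "cell_eval (Suc m) P (g, j) = (\<Sum>(w, l)\<leftarrow>concat (map V es). w * P (map ((\<otimes>) g) l))"
    if g: "g \<in> carrier G" for P g
  proof -
    have "cell_eval (Suc m) P (g, j) = (\<Sum>e\<leftarrow>es. ?d e * cell_eval m (\<lambda>ys. P (g # ys)) (g \<otimes> fst e, snd e))"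
      using es by (simp add: ccob_def pair_def sum_list_distinct_conv_sum_set)
    also have "\<dots> = (\<Sum>e\<leftarrow>es. \<Sum>(w, l)\<leftarrow>V e. w * P (map ((\<otimes>) g) l))"
      using V[OF _ g] by (intro arg_cong[of _ _ sum_list] map_cong) auto
    also have "\<dots> = (\<Sum>(w, l)\<leftarrow>concat (map V es). w * P (map ((\<otimes>) g) l))"
      by (induction es) auto
    finally show ?thesis .
  qed
  moreover have "\<forall>(w, l)\<in>set (concat (map V es)). set l \<subseteq> carrier G \<and> length l = Suc (Suc m)"
  proof (safe)
    fix w l assume "(w, l) \<in> set (concat (map V es))"
    then obtain e w' l' where e: "e \<in> set es" "(w', l') \<in> set (W (snd e))"
        and l: "l = \<one> # map ((\<otimes>) (fst e)) l'"
      by (auto simp: V_def)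
    have "set l' \<subseteq> carrier G" "length l' = Suc m" using W1[OF cell(2)[OF e(1)] e(2)] by auto
    then show "length l = Suc (Suc m)" "\<And>x. x \<in> set l \<Longrightarrow> x \<in> carrier G"
      using l cell(1)[OF e(1)] by auto
  qed
  ultimately show ?case by (intro exI[of _ "concat (map V es)"]) blast
qed

section \<open>The composite through the bar complex, and its homotopy to the identity\<close>

definition bar_comp :: "nat \<Rightarrow> nat \<Rightarrow> 'g \<times> nat \<Rightarrow> int" where
  "bar_comp m j = (\<lambda>c. cell_eval m (\<lambda>xs. bar_chain m xs c) (\<one>, j))"

lemma cell_eval_cong:
  assumes "g \<in> carrier G" "j < k m"
    and "\<And>xs. set xs \<subseteq> carrier G \<Longrightarrow> length xs = Suc m \<Longrightarrow> P xs = Q xs"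
  shows "cell_eval m P (g, j) = cell_eval m Q (g, j)"
proof -
  obtain ws :: "(int \<times> 'g list) list" where
    ws: "\<forall>(w, l)\<in>set ws. set l \<subseteq> carrier G \<and> length l = Suc m"
      "\<forall>P. \<forall>g\<in>carrier G. cell_eval m P (g, j) = (\<Sum>(w, l)\<leftarrow>ws. w * P (map ((\<otimes>) g) l))"
    using cell_eval_representation[OF assms(2)] by blast
  have "P (map ((\<otimes>) g) l) = Q (map ((\<otimes>) g) l)" if "(w, l) \<in> set ws" for w l
    using bspec[OF ws(1) that] assms(1) by (intro assms(3)) auto
  then show ?thesis
    using ws(2) assms(1) by (simp, intro arg_cong[of _ _ sum_list] map_cong) auto
qed

text \<open>The simplices representing a cell are moved by \<open>g\<close>, and
  \<open>bar_chain\<close> commutes with \<open>g\<close>, so the composite is equivariant. The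
  third part says that pulling back in two stages is dual to it.\<close>

lemma cell_eval_bar_chain:
  assumes g: "g \<in> carrier G" and j: "j < k m"
  shows "translate G g (bar_comp m j) = (\<lambda>c. cell_eval m (\<lambda>xs. bar_chain m xs c) (g, j))"
    and "translate G g (bar_comp m j) \<in> chains G (k m)"
    and "pair \<phi> (translate G g (bar_comp m j)) = cell_eval m (\<lambda>xs. pair \<phi> (bar_chain m xs)) (g, j)"
proof -
  obtain ws :: "(int \<times> 'g list) list" where
    ws: "\<forall>(w, l)\<in>set ws. set l \<subseteq> carrier G \<and> length l = Suc m"
      "\<forall>P. \<forall>g\<in>carrier G. cell_eval m P (g, j) = (\<Sum>(w, l)\<leftarrow>ws. w * P (map ((\<otimes>) g) l))"
    using cell_eval_representation[OF j] by blast
  have ev: "(\<lambda>c. cell_eval m (\<lambda>xs. bar_chain m xs c) (h, j)) = (\<lambda>c. \<Sum>(w, l)\<leftarrow>ws. w * translate G h (bar_chain m l) c)"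
    if h: "h \<in> carrier G" for h
  proof
    fix c
    show "cell_eval m (\<lambda>xs. bar_chain m xs c) (h, j) = (\<Sum>(w, l)\<leftarrow>ws. w * translate G h (bar_chain m l) c)"
      using ws h bar_chain_equivariant[OF h]
      by (simp, intro arg_cong[of _ _ sum_list] map_cong) auto
  qed
  have "bar_comp m j = (\<lambda>c. \<Sum>(w, l)\<leftarrow>ws. w * bar_chain m l c)"
    unfolding bar_comp_def ev[OF one_closed]
    using ws(1) bar_chain_spec translate_one
    by (intro ext arg_cong[of _ _ sum_list] map_cong) fastforce+
  moreover have "translate G g (\<lambda>c. \<Sum>(w, l)\<leftarrow>ws. w * bar_chain m l c) = (\<lambda>c. \<Sum>(w, l)\<leftarrow>ws. w * translate G g (bar_chain m l) c)"
    by (auto simp: translate_def fun_eq_iff case_prod_unfold)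
  ultimately show eq: "translate G g (bar_comp m j) = (\<lambda>c. cell_eval m (\<lambda>xs. bar_chain m xs c) (g, j))"
    using ev[OF g] by simp
  have ch: "translate G g (bar_chain m l) \<in> chains G (k m)" if "(w, l) \<in> set ws" for w l
    using that ws(1) bar_chain_spec[of l m] g by (intro translate_chains) auto
  show "translate G g (bar_comp m j) \<in> chains G (k m)"
    unfolding eq ev[OF g] using ch by (intro chains_sum_list(1))
  have "pair \<phi> (translate G g (bar_comp m j)) = (\<Sum>(w, l)\<leftarrow>ws. w * pair \<phi> (translate G g (bar_chain m l)))"
    unfolding eq ev[OF g] using ch by (intro chains_sum_list(2))
  also have "\<dots> = cell_eval m (\<lambda>xs. pair \<phi> (bar_chain m xs)) (g, j)"
    using ws g bar_chain_equivariant[OF g]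
    by (simp, intro arg_cong[of _ _ sum_list] map_cong) auto
  finally show "pair \<phi> (translate G g (bar_comp m j)) = cell_eval m (\<lambda>xs. pair \<phi> (bar_chain m xs)) (g, j)" .
qed

lemma bar_comp_translate_one: "j < k m \<Longrightarrow> translate G \<one> (bar_comp m j) = bar_comp m j"
  using cell_eval_bar_chain(1)[OF one_closed] by (simp add: bar_comp_def)

lemma bar_comp_chain: "j < k m \<Longrightarrow> bar_comp m j \<in> chains G (k m)"
  using cell_eval_bar_chain(2)[OF one_closed] bar_comp_translate_one by metis

lemma pair_bar_comp: "j < k m \<Longrightarrow> pair \<phi> (bar_comp m j) = cell_eval m (\<lambda>xs. pair \<phi> (bar_chain m xs)) (\<one>, j)"
  using cell_eval_bar_chain(3)[OF one_closed] bar_comp_translate_one by metis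

lemma aug_bar_comp: "j < k 0 \<Longrightarrow> aug eps (bar_comp 0 j) = eps j"
  using pair_bar_comp[of j 0] bar_chain_spec[of "[\<one>]" 0] by (simp add: aug_pair)

text \<open>Both halves are chain maps: \<open>bar_chain_spec\<close> turns the boundary into
  \<open>cobd\<close>, and \<open>cell_eval_cobd\<close> turns \<open>cobd\<close> into the boundary
  of the cell.\<close>

lemma bdry_bar_comp:
  assumes j: "j < k (Suc m)"
  shows "bdry G (d (Suc m)) (bar_comp (Suc m) j) = bdry G (bar_comp m) (d (Suc m) j)"
proof (rule ext)
  fix x
  have "bdry G (d (Suc m)) (bar_comp (Suc m) j) x = cell_eval (Suc m) (\<lambda>xs. bdry G (d (Suc m)) (bar_chain (Suc m) xs) x) (\<one>, j)"
    unfolding bdry_pair by (rule pair_bar_comp[OF j])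
  also have "\<dots> = cell_eval (Suc m) (cobd (\<lambda>ys. bar_chain m ys x)) (\<one>, j)"
    using bar_chain_spec[of _ "Suc m"] by (intro cell_eval_cong[OF one_closed j]) (auto simp del: bar_chain.simps)
  also have "\<dots> = ccob G (d (Suc m)) (cell_eval m (\<lambda>ys. bar_chain m ys x)) (\<one>, j)"
    using cell_eval_cobd[of "(\<one>, j)"] j by simp
  also have "\<dots> = bdry G (bar_comp m) (d (Suc m) j) x"
    unfolding ccob_def bdry_pair
  proof (simp, rule pair_cong)
    fix c assume "d (Suc m) j c \<noteq> 0"
    then have c: "fst c \<in> carrier G" "snd c < k m" using chains_cell[OF d_chain[OF j]] by auto
    show "cell_eval m (\<lambda>ys. bar_chain m ys x) (\<one> \<otimes> fst c, snd c) = translate G (fst c) (bar_comp m (snd c)) x"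
      using cell_eval_bar_chain(1)[OF c] c by simp
  qed
  finally show "bdry G (d (Suc m)) (bar_comp (Suc m) j) x = bdry G (bar_comp m) (d (Suc m) j) x" .
qed

text \<open>\<open>homotopy\<close> is a chain homotopy from the identity to the chain map \<open>bar_comp\<close>.\<close>

primrec homotopy :: "nat \<Rightarrow> nat \<Rightarrow> 'g \<times> nat \<Rightarrow> int" where
  "homotopy 0 = (\<lambda>j. fill 0 (\<lambda>c. bar_comp 0 j c - basis (\<one>, j) c))"
| "homotopy (Suc m) = (\<lambda>j. fill (Suc m) (\<lambda>c. bar_comp (Suc m) j c - basis (\<one>, j) c - bdry G (homotopy m) (d (Suc m) j) c))"

text \<open>The argument of \<open>fill\<close> has to be a cycle. Writing \<open>H\<close> for the
  homotopy and \<open>f\<close> for \<open>bar_comp\<close>, the formula one degree lower gives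
  \<open>d (H d) = f d - d - H d d\<close> with \<open>d d = 0\<close>, which is the boundary of
  \<open>f - id\<close>. In degree 0, \<open>f\<close> and \<open>id\<close> have the same
  augmentation.\<close>

lemma homotopy_spec:
  assumes "j < k m"
  shows "homotopy m j \<in> chains G (k (Suc m)) \<and>
    bdry G (d (Suc m)) (homotopy m j) = (\<lambda>c. bar_comp m j c - basis (\<one>, j) c -
      (if m = 0 then 0 else bdry G (homotopy (m - 1)) (d m j) c))"
  using assms
proof (induction m arbitrary: j)
  case 0
  have "cycle 0 (\<lambda>c. bar_comp 0 j c - basis (\<one>, j) c)"
    unfolding cycle_def
    using 0 bar_comp_chain[OF 0] basis_chain[OF one_closed 0] aug_bar_comp[OF 0]
    by (simp add: chains_diff aug_pair pair_diff chains_finite pair_basis)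
  from fill[OF this] show ?case by simp
next
  case (Suc m)
  let ?f = "\<lambda>c. bar_comp (Suc m) j c - basis (\<one>, j) c"
  let ?d = "d (Suc m) j"
  have dch: "?d \<in> chains G (k m)" using d_chain Suc.prems by blast
  have f: "?f \<in> chains G (k (Suc m))"
    using bar_comp_chain[OF Suc.prems] basis_chain[OF one_closed Suc.prems] by (rule chains_diff)
  have H: "bdry G (homotopy m) ?d \<in> chains G (k (Suc m))"
    using bdry_chains[OF dch] Suc.IH by blast
  have "bdry G (d (Suc m)) (bdry G (homotopy m) ?d) = bdry G (\<lambda>j. bdry G (d (Suc m)) (homotopy m j)) ?d"
    using bdry_bdry[OF dch] Suc.IH by blast
  also have "\<dots> = bdry G (\<lambda>j c. bar_comp m j c - basis (\<one>, j) c -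
      (if m = 0 then 0 else bdry G (homotopy (m - 1)) (d m j) c)) ?d"
    using Suc.IH by (intro bdry_cong[OF dch]) blast
  also have "\<dots> = (\<lambda>x. bdry G (bar_comp m) ?d x - ?d x)"
  proof
    fix x
    have "bdry G (\<lambda>j c. if m = 0 then 0 else bdry G (homotopy (m - 1)) (d m j) c) ?d x = 0"
    proof (cases m)
      case 0
      then show ?thesis by (simp add: bdry_pair)
    next
      case (Suc l)
      have "bdry G (\<lambda>j. bdry G (homotopy l) (d m j)) ?d = bdry G (homotopy l) (bdry G (d m) ?d)"
        using bdry_bdry[OF dch, of "d m" "k l" "homotopy l"] d_chain Suc by auto
      moreover have "bdry G (d m) ?d = (\<lambda>_. 0)"
        using d_cycle[OF Suc.prems] Suc by (simp add: cycle_def)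
      ultimately show ?thesis using Suc by simp
    qed
    then show "bdry G (\<lambda>j c. bar_comp m j c - basis (\<one>, j) c -
      (if m = 0 then 0 else bdry G (homotopy (m - 1)) (d m j) c)) ?d x = bdry G (bar_comp m) ?d x - ?d x"
      using bdry_identity[OF dch] by (simp add: bdry_diff_left)
  qed
  finally have 1: "bdry G (d (Suc m)) (bdry G (homotopy m) ?d) = (\<lambda>x. bdry G (bar_comp m) ?d x - ?d x)" .
  have "bdry G (d (Suc m)) ?f = (\<lambda>x. bdry G (bar_comp m) ?d x - ?d x)"
    using bdry_diff[OF bar_comp_chain[OF Suc.prems] basis_chain[OF one_closed Suc.prems]]
      bdry_bar_comp[OF Suc.prems] bdry_basis_one[where b = "d (Suc m)", OF dch] by simp
  then have "bdry G (d (Suc m)) (\<lambda>c. ?f c - bdry G (homotopy m) ?d c) = (\<lambda>_. 0)"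
    using bdry_diff[OF f H] 1 by simp
  then have "cycle (Suc m) (\<lambda>c. ?f c - bdry G (homotopy m) ?d c)"
    using chains_diff[OF f H] by (simp add: cycle_def)
  from fill[OF this] show ?case by simp
qed

text \<open>Finite rank enters here: one bound for each orbit of cells gives a bound on all
  cells.\<close>

lemma uniform_bound:
  fixes f :: "'g \<Rightarrow> nat \<Rightarrow> int"
  assumes "\<And>j. j < r \<Longrightarrow> \<exists>b. \<forall>g\<in>carrier G. \<bar>f g j\<bar> \<le> b"
  shows "\<exists>b. \<forall>g\<in>carrier G. \<forall>j<r. \<bar>f g j\<bar> \<le> b"
  using assms
proof (induction r)
  case (Suc r)
  then obtain b where "\<forall>g\<in>carrier G. \<forall>j<r. \<bar>f g j\<bar> \<le> b" by (meson less_SucI)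
  moreover obtain b' where "\<forall>g\<in>carrier G. \<bar>f g r\<bar> \<le> b'" using Suc.prems by blast
  ultimately have "\<forall>g\<in>carrier G. \<forall>j<Suc r. \<bar>f g j\<bar> \<le> max b b'"
    by (auto simp: less_Suc_eq le_max_iff_disj)
  then show ?case by blast
qed auto

end

section \<open>Transfer of the bounded primitive from the bar complex to the resolution\<close>

theorem theorem2p3:
  fixes G :: "'g monoid"
    and k :: "nat \<Rightarrow> nat"
    and d :: "nat \<Rightarrow> nat \<Rightarrow> ('g \<times> nat \<Rightarrow> int)"
    and eps :: "nat \<Rightarrow> int"
    and i :: nat
  assumes "hyperbolic_group G"
    and "free_resolution_fin_type G k d eps"
    and "i > 1"
  shows "linf_cohomology_vanishes G k d i"
  unfolding linf_cohomology_vanishes_def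
proof (intro allI impI, elim conjE)
  fix \<phi>
  assume bdd: "bounded_cochain G k i \<phi>"
    and coc: "\<forall>g\<in>carrier G. \<forall>j<k (Suc i). coboundary G d i \<phi> (g, j) = 0"
  from assms(1) obtain S \<delta> where grp: "group G" and S: "finite S" "S \<subseteq> carrier G" "generate G S = carrier G"
    and \<delta>: "\<delta> \<ge> 0" "\<forall>w\<in>carrier G. \<forall>x\<in>carrier G. \<forall>y\<in>carrier G. \<forall>z\<in>carrier G.
           gromov_product G S w x z \<ge> min (gromov_product G S w x y) (gromov_product G S w y z) - \<delta>"
    unfolding hyperbolic_group_def by blast
  interpret group G by (rule grp)
  interpret W: word_metric G S by unfold_locales (use S in auto)
  interpret R: resolution G k d eps by unfold_locales (rule assms(2))
  interpret H: hyperbolic_space "carrier G" "\<one>\<^bsub>G\<^esub>" W.wd "nat \<lceil>2 * \<delta>\<rceil>"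
    by (rule W.hyperbolic_space_wd[OF \<delta>])
  obtain p where i: "i = Suc p" using assms(3) by (cases i) auto
  obtain b where b: "\<And>g j. g \<in> carrier G \<Longrightarrow> j < k i \<Longrightarrow> \<bar>\<phi> (g, j)\<bar> \<le> b"
    using bdd by (auto simp: bounded_cochain_def)
  have cocycle: "pair \<phi> (bdry G (d (Suc i)) f) = 0" if f: "f \<in> chains G (k (Suc i))" for f
  proof -
    have "pair \<phi> (bdry G (d (Suc i)) f) = pair (ccob G (d (Suc i)) \<phi>) f"
      using R.d_chain by (intro R.pair_bdry[OF f])
    also have "\<dots> = pair (\<lambda>_. 0) f"
      using coc chains_cell[OF f] by (intro pair_cong) (auto simp: coboundary_ccob)
    finally show ?thesis by simp
  qed
  \<comment> \<open>\<open>b\<close> times the l1-norm, which bounds \<open>\<phi>\<close> on all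
    translates of a chain at once.\<close>
  define norm1 where "norm1 f = pair (\<lambda>_. b) (\<lambda>c. \<bar>f c\<bar>)" for f :: "'g \<times> nat \<Rightarrow> int"
  have pair_le: "\<bar>pair \<phi> (translate G g f)\<bar> \<le> norm1 f" if g: "g \<in> carrier G" and f: "f \<in> chains G (k i)" for g f
    unfolding R.pair_translate[OF g f] norm1_def
    using chains_cell[OF f] g by (intro pair_bound b) auto
  define F where "F xs = pair \<phi> (R.bar_chain i xs)" for xs

  interpret C: hyperbolic_cocycle "carrier G" "\<one>\<^bsub>G\<^esub>" W.wd "nat \<lceil>2 * \<delta>\<rceil>" i "\<lambda>xs. real_of_int (F xs)"
  proof
    show "2 \<le> i" using assms(3) by simp
    have "R.bar_chain i xs = (\<lambda>_. 0)" if "\<not> distinct_adj xs" for xs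
      using R.bar_chain_normalized that by (auto simp: normalized_def)
    then show "normalized (\<lambda>xs. real_of_int (F xs))"
      by (simp add: normalized_def F_def)
  next
    fix xs assume xs: "set xs \<subseteq> carrier G" "length xs = Suc (Suc i)"
    have "finite {c. R.bar_chain i ys c \<noteq> 0}" if "set ys \<subseteq> set xs" "Suc (length ys) = length xs" for ys
      using R.bar_chain_spec[of ys i] that xs by (auto intro!: chains_finite)
    then have "cobd F xs = pair \<phi> (\<lambda>c. cobd (\<lambda>ys. R.bar_chain i ys c) xs)"
      unfolding F_def using pair_cobd[of xs "R.bar_chain i" \<phi>] by simp
    also have "\<dots> = pair \<phi> (bdry G (d (Suc i)) (R.bar_chain (Suc i) xs))"
      using R.bar_chain_spec[OF xs] by simp
    also have "\<dots> = 0" using R.bar_chain_spec[OF xs] cocycle by blast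
    finally show "cobd (\<lambda>xs. real_of_int (F xs)) xs = 0" by (simp add: cobd_of_int)
  next
    fix D
    \<comment> \<open>Moving the first vertex to \<open>\<one>\<close> puts every simplex of
      diameter at most \<open>D\<close> into this finite set, and \<open>norm1\<close> is
      insensitive to the translation.\<close>
    let ?W = "{ys. set ys \<subseteq> {x \<in> carrier G. W.wl x \<le> D} \<and> length ys = Suc i}"
    define B where "B = (\<Sum>ys\<in>?W. \<bar>norm1 (R.bar_chain i ys)\<bar>)"
    have fin: "finite ?W" using W.finite_wl_ball by (rule finite_lists_length_eq)
    have "\<bar>real_of_int (F xs)\<bar> \<le> real_of_int B"
      if xs: "set xs \<subseteq> carrier G" "length xs = Suc i" "H.small D xs" for xs
    proof -
      define x where "x = hd xs"
      define ys where "ys = map ((\<otimes>\<^bsub>G\<^esub>) (inv\<^bsub>G\<^esub> x)) xs"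
      have x: "x \<in> set xs" "x \<in> carrier G" using xs by (cases xs; auto simp: x_def)+
      have ys: "ys \<in> ?W" "set ys \<subseteq> carrier G" "length ys = Suc i"
        using xs x by (auto simp: ys_def H.small_def W.wd_def)
      have "map ((\<otimes>\<^bsub>G\<^esub>) x) ys = xs"
        unfolding ys_def map_map using xs x inv_mult_cancel by (intro map_idI) auto
      then have "R.bar_chain i xs = translate G x (R.bar_chain i ys)"
        using R.bar_chain_equivariant[OF x(2) ys(2,3)] by simp
      then have "\<bar>F xs\<bar> \<le> norm1 (R.bar_chain i ys)"
        using pair_le[OF x(2)] R.bar_chain_spec[OF ys(2,3)] by (simp add: F_def)
      also have "\<dots> \<le> B"
        unfolding B_def using member_le_sum[OF ys(1), of "\<lambda>ys. \<bar>norm1 (R.bar_chain i ys)\<bar>"] fin by linarith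
      finally show ?thesis by linarith
    qed
    then show "\<exists>B. \<forall>xs. set xs \<subseteq> carrier G \<longrightarrow> length xs = Suc i \<longrightarrow> H.small D xs \<longrightarrow> \<bar>real_of_int (F xs)\<bar> \<le> B"
      by blast
  qed

  obtain Q :: "'g list \<Rightarrow> int" where
    Q1: "\<And>xs. set xs \<subseteq> carrier G \<Longrightarrow> length xs = Suc i \<Longrightarrow> cobd Q xs = F xs" and
    Q2: "\<And>D. \<exists>B. \<forall>xs. set xs \<subseteq> carrier G \<longrightarrow> length xs = i \<longrightarrow> H.small D xs \<longrightarrow> \<bar>Q xs\<bar> \<le> B"
    using C.bounded_primitive_int[OF refl] by blast
  \<comment> \<open>With \<open>f\<close> for \<open>bar_comp\<close> and \<open>H\<close> for the
    homotopy, \<open>f - id = d H + H d\<close>. A cocycle kills \<open>d H\<close>, so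
    \<open>\<phi>\<close> is the pullback of \<open>\<phi>\<close> along \<open>f\<close> minus its
    pullback along \<open>H d\<close>; the two terms of \<open>\<psi>\<close> are primitives of
    these.\<close>
  define \<psi> where "\<psi> c = R.cell_eval p Q c - ccob G (R.homotopy p) \<phi> c" for c

  have "coboundary G d (i - 1) \<psi> (g, j) = \<phi> (g, j)" if g: "g \<in> carrier G" and j: "j < k i" for g j
  proof -
    have jp: "j < k (Suc p)" using j i by simp
    have dch: "d i j \<in> chains G (k p)" using R.d_chain[OF jp] i by simp
    have Hch: "R.homotopy p l \<in> chains G (k i)" if "l < k p" for l
      using R.homotopy_spec[OF that] i by simp
    have HB: "bdry G (R.homotopy p) (d i j) \<in> chains G (k i)" using R.bdry_chains[OF dch] Hch by blast
    have E: "basis (\<one>\<^bsub>G\<^esub>, j) \<in> chains G (k i)" using R.basis_chain j by simp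
    have "ccob G (d i) (R.cell_eval p Q) (g, j) = R.cell_eval i (cobd Q) (g, j)"
      using R.cell_eval_cobd[of "(g, j)" p Q] g j i by simp
    also have "\<dots> = R.cell_eval i F (g, j)"
      using Q1 by (intro R.cell_eval_cong[OF g j])
    also have "\<dots> = pair \<phi> (translate G g (R.bar_comp i j))"
      using R.cell_eval_bar_chain(3)[OF g j] by (simp add: F_def[abs_def])
    finally have 1: "ccob G (d i) (R.cell_eval p Q) (g, j) = pair \<phi> (translate G g (R.bar_comp i j))" .
    have "ccob G (d i) (ccob G (R.homotopy p) \<phi>) (g, j) = pair (ccob G (R.homotopy p) \<phi>) (translate G g (d i j))"
      using R.ccob_translate[of "(g, j)" "d i"] g dch by simp
    also have "\<dots> = pair \<phi> (translate G g (bdry G (R.homotopy p) (d i j)))"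
      using R.pair_bdry[OF R.translate_chains[OF g dch], of "R.homotopy p" "k i" \<phi>] Hch
        R.bdry_translate[OF g dch] by simp
    finally have 2: "ccob G (d i) (ccob G (R.homotopy p) \<phi>) (g, j) = pair \<phi> (translate G g (bdry G (R.homotopy p) (d i j)))" .
    have Hi: "R.homotopy i j \<in> chains G (k (Suc i))"
      "bdry G (d (Suc i)) (R.homotopy i j) = (\<lambda>c. R.bar_comp i j c - basis (\<one>\<^bsub>G\<^esub>, j) c - bdry G (R.homotopy p) (d i j) c)"
      using R.homotopy_spec[OF j] i by auto
    note T = R.translate_chains[OF g R.bar_comp_chain[OF j]] R.translate_chains[OF g E] R.translate_chains[OF g HB]
    have "0 = pair \<phi> (bdry G (d (Suc i)) (translate G g (R.homotopy i j)))"
      using cocycle[OF R.translate_chains[OF g Hi(1)]] by simp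
    also have "\<dots> = pair \<phi> (\<lambda>c. translate G g (R.bar_comp i j) c - translate G g (basis (\<one>\<^bsub>G\<^esub>, j)) c
        - translate G g (bdry G (R.homotopy p) (d i j)) c)"
      using R.bdry_translate[OF g Hi(1)] Hi(2) by (simp add: translate_diff)
    also have "\<dots> = pair \<phi> (translate G g (R.bar_comp i j)) - pair \<phi> (translate G g (basis (\<one>\<^bsub>G\<^esub>, j)))
        - pair \<phi> (translate G g (bdry G (R.homotopy p) (d i j)))"
      unfolding pair_diff[OF chains_finite[OF chains_diff[OF T(1,2)]] chains_finite[OF T(3)]]
        pair_diff[OF chains_finite[OF T(1)] chains_finite[OF T(2)]] ..
    finally have "pair \<phi> (translate G g (R.bar_comp i j)) - pair \<phi> (translate G g (bdry G (R.homotopy p) (d i j))) = \<phi> (g, j)"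
      by (simp add: R.translate_basis[OF g] pair_basis)
    then show ?thesis
      using 1 2 i by (simp add: coboundary_ccob \<psi>_def[abs_def] ccob_diff)
  qed
  moreover have "bounded_cochain G k (i - 1) \<psi>"
  proof -
    have "\<exists>B. \<forall>g\<in>carrier G. \<bar>\<psi> (g, j)\<bar> \<le> B" if j: "j < k p" for j
    proof -
      obtain ws :: "(int \<times> 'g list) list" where
        ws: "\<forall>(w, l)\<in>set ws. set l \<subseteq> carrier G \<and> length l = Suc p"
          "\<forall>P. \<forall>g\<in>carrier G. R.cell_eval p P (g, j) = (\<Sum>(w, l)\<leftarrow>ws. w * P (map ((\<otimes>\<^bsub>G\<^esub>) g) l))"
        using R.cell_eval_representation[OF j] by blast
      have Qb: "\<exists>B. \<forall>g\<in>carrier G. \<bar>Q (map ((\<otimes>\<^bsub>G\<^esub>) g) l)\<bar> \<le> B" if l: "set l \<subseteq> carrier G" "length l = Suc p" for l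
      proof -
        \<comment> \<open>A crude bound for the diameter of \<open>l\<close>. Translates of
          \<open>l\<close> have the same diameter, so a single bound on \<open>Q\<close> serves all
          \<open>g\<close>.\<close>
        define D where "D = (\<Sum>x\<in>set l. \<Sum>y\<in>set l. W.wd x y)"
        have D: "W.wd x y \<le> D" if "x \<in> set l" "y \<in> set l" for x y
        proof -
          have "W.wd x y \<le> (\<Sum>y\<in>set l. W.wd x y)" using that by (intro member_le_sum) auto
          also have "\<dots> \<le> D" unfolding D_def
            using that member_le_sum[of x "set l" "\<lambda>x. \<Sum>y\<in>set l. W.wd x y"] by simp
          finally show ?thesis .
        qed
        obtain B where B: "\<forall>xs. set xs \<subseteq> carrier G \<longrightarrow> length xs = i \<longrightarrow> H.small D xs \<longrightarrow> \<bar>Q xs\<bar> \<le> B"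
          using Q2 by blast
        have "\<bar>Q (map ((\<otimes>\<^bsub>G\<^esub>) g) l)\<bar> \<le> B" if g: "g \<in> carrier G" for g
        proof -
          have "H.small D (map ((\<otimes>\<^bsub>G\<^esub>) g) l)"
            using D W.wd_left_invariant[OF g] l by (auto simp: H.small_def subset_iff)
          moreover have "set (map ((\<otimes>\<^bsub>G\<^esub>) g) l) \<subseteq> carrier G" using l g by auto
          ultimately show ?thesis using B l i by simp
        qed
        then show ?thesis by blast
      qed
      have "\<exists>B. \<forall>g\<in>carrier G. \<bar>\<Sum>(w, l)\<leftarrow>ws. w * Q (map ((\<otimes>\<^bsub>G\<^esub>) g) l)\<bar> \<le> B"
        using ws(1)
      proof (induction ws)
        case (Cons a ws)
        obtain w l where a: "a = (w, l)" by fastforce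
        obtain B where B: "\<forall>g\<in>carrier G. \<bar>\<Sum>(w, l)\<leftarrow>ws. w * Q (map ((\<otimes>\<^bsub>G\<^esub>) g) l)\<bar> \<le> B"
          using Cons by auto
        obtain B' where B': "\<forall>g\<in>carrier G. \<bar>Q (map ((\<otimes>\<^bsub>G\<^esub>) g) l)\<bar> \<le> B'"
          using Qb[of l] Cons.prems a by auto
        have "\<bar>w * Q (map ((\<otimes>\<^bsub>G\<^esub>) g) l) + (\<Sum>(w, l)\<leftarrow>ws. w * Q (map ((\<otimes>\<^bsub>G\<^esub>) g) l))\<bar> \<le> \<bar>w\<bar> * B' + B"
          if g: "g \<in> carrier G" for g
        proof -
          have "\<bar>w * Q (map ((\<otimes>\<^bsub>G\<^esub>) g) l)\<bar> \<le> \<bar>w\<bar> * B'"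
            using B' g by (simp add: abs_mult mult_left_mono)
          then show ?thesis using bspec[OF B g] by linarith
        qed
        then show ?case by (intro exI[of _ "\<bar>w\<bar> * B' + B"]) (simp add: a)
      qed auto
      then obtain B where B: "\<And>g. g \<in> carrier G \<Longrightarrow> \<bar>R.cell_eval p Q (g, j)\<bar> \<le> B"
        using ws(2) by auto
      have "\<bar>\<psi> (g, j)\<bar> \<le> B + norm1 (R.homotopy p j)" if g: "g \<in> carrier G" for g
      proof -
        have Hch: "R.homotopy p j \<in> chains G (k i)" using R.homotopy_spec[OF j] i by simp
        have "\<bar>ccob G (R.homotopy p) \<phi> (g, j)\<bar> \<le> norm1 (R.homotopy p j)"
          using pair_le[OF g Hch] R.ccob_translate[of "(g, j)" "R.homotopy p"] g Hch by simp
        then show ?thesis using B[OF g] by (simp add: \<psi>_def)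
      qed
      then show ?thesis by blast
    qed
    then show ?thesis
      unfolding bounded_cochain_def using R.uniform_bound[of "k p" "\<lambda>g j. \<psi> (g, j)"] i by simp
  qed
  ultimately show "\<exists>\<psi>. bounded_cochain G k (i - 1) \<psi> \<and>
      (\<forall>g\<in>carrier G. \<forall>j<k i. coboundary G d (i - 1) \<psi> (g, j) = \<phi> (g, j))"
    by blast
qed

end
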